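(* For a prime $q\ge3$, let $S$ be chosen uniformly at random among all $\frac{q-1}{2}$-element subsets of $\mathbb{F}_q$. Then the probability that $$\mathrm{Aut}(G_S)=\{\,v\mapsto \lambda v+b:\ \lambda\in\mathbb{F}_q^*,\ b\in\mathbb{F}_q^2\,\}$$ tends to $1$ as $q\to\infty$ through the primes. Consequently, asymptotically almost surely $|\mathrm{Aut}(G_S)|=q^2(q-1)$.
   Context: The graph $G_S$ has vertex set $\mathbb{F}_q^2$, and $u=(u_1,u_2)$, $v=(v_1,v_2)$ are adjacent iff $u_1\neq v_1$ and $(v_2-u_2)(v_1-u_1)^{-1}\in S$. *)

theory Defs
  imports "HOL-Analysis.Analysis" "HOL-Number_Theory.Number_Theory"
begin

text \<open>The prime field F_q, realised as the residue ring Z/qZ (carrier {0..q-1}).\<close>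
abbreviation Fq :: "nat \<Rightarrow> int ring" where
  "Fq q \<equiv> residue_ring (int q)"

definition verts :: "nat \<Rightarrow> (int \<times> int) set" where
  "verts q = carrier (Fq q) \<times> carrier (Fq q)"

definition adjS :: "nat \<Rightarrow> int set \<Rightarrow> int \<times> int \<Rightarrow> int \<times> int \<Rightarrow> bool" where
  "adjS q S u v \<longleftrightarrow> fst u \<noteq> fst v \<and>
     (snd v \<ominus>\<^bsub>Fq q\<^esub> snd u) \<otimes>\<^bsub>Fq q\<^esub> inv\<^bsub>Fq q\<^esub> (fst v \<ominus>\<^bsub>Fq q\<^esub> fst u) \<in> S"

definition AutG :: "nat \<Rightarrow> int set \<Rightarrow> (int \<times> int \<Rightarrow> int \<times> int) set" where
  "AutG q S = {f \<in> extensional (verts q). bij_betw f (verts q) (verts q) \<and>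
     (\<forall>u\<in>verts q. \<forall>v\<in>verts q. adjS q S u v \<longleftrightarrow> adjS q S (f u) (f v))}"

definition affine_scalings :: "nat \<Rightarrow> (int \<times> int \<Rightarrow> int \<times> int) set" where
  "affine_scalings q = {(\<lambda>v\<in>verts q. (l \<otimes>\<^bsub>Fq q\<^esub> fst v \<oplus>\<^bsub>Fq q\<^esub> fst b,
                                       l \<otimes>\<^bsub>Fq q\<^esub> snd v \<oplus>\<^bsub>Fq q\<^esub> snd b)) | l b.
      l \<in> carrier (Fq q) - {\<zero>\<^bsub>Fq q\<^esub>} \<and> b \<in> verts q}"

definition half_subsets :: "nat \<Rightarrow> int set set" where
  "half_subsets q = {S. S \<subseteq> carrier (Fq q) \<and> card S = (q - 1) div 2}"

definition probS :: "nat \<Rightarrow> (int set \<Rightarrow> bool) \<Rightarrow> real" where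
  "probS q P = real (card {S \<in> half_subsets q. P S}) / real (card (half_subsets q))"

end

theory Submission
  imports Defs "HOL-Real_Asymp.Real_Asymp"
begin

text \<open>A clique of size q is the graph of a function on the prime field that determines at most
  (q - 1)/2 directions, hence a line by Redei's theorem. So an automorphism maps lines with slope
  in S to such lines and permutes the parallel classes in S. As it respects three parallel classes,
  it is affine by Cauchy's functional equation, and its linear part acts on the slopes as a Moebius
  transformation preserving S. A nonidentity Moebius transformation has at most two fixed points,
  so it preserves at most about 2^(2q/3) subsets, while there are at least 2^q/(q + 1) choices
  of S and at most q^4 matrices: almost surely only scalar matrices survive.\<close>

text \<open>Vertices with equal first coordinates are never adjacent, so a clique meets each of the
  q columns at most once; this is why a q-clique is the graph of a function on the whole field. The
  choice of (q - 1)/2 slopes leaves (q + 1)/2 residues outside S, and that is exactly the number of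
  non-directions which the polynomial argument consumes. Lines with slope outside S are invisible to
  the graph, so affinity cannot be deduced from the preservation of all lines; three visible
  parallel classes have to suffice. Slopes are moved on the projective line, but S contains finite
  slopes only. Hence one residue, the pole, is discarded besides the at most two fixed points, which
  explains the q - 3 in the exponent. The division by 3 is forced by cycles of length 3: a set
  disjoint from its image holds at most one point of each. The saving is still exponential, so the
  polynomial factors q^4 and q + 1 do no harm.\<close>

hide_const (open) UnivPoly.coeff UnivPoly.monom Module.smult

section \<open>Functions with few directions\<close>

text \<open>The differences (x + 1)^(j+1) - x^(j+1) telescope to q^(j+1). Expanding them expresses
  (j + 1) times the j-th power sum through lower power sums, and j + 1 < q is invertible.\<close>

lemma sum_powers_mod_prime:
  fixes q j :: nat
  assumes "prime q" "j < q - 1"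
  shows "int q dvd (\<Sum>x<q. int x ^ j)"
  using assms(2)
proof (induction j rule: less_induct)
  case (less j)
  have pr: "prime (int q)" using assms by simp
  have "(\<Sum>x<q. int (Suc x) ^ Suc j - int x ^ Suc j) = int q ^ Suc j - int 0 ^ Suc j"
    by (rule sum_lessThan_telescope)
  moreover have "int (Suc x) ^ Suc j - int x ^ Suc j = (\<Sum>i\<le>j. int (Suc j choose i) * int x ^ i)" for x
  proof -
    have "int (Suc x) ^ Suc j = (int x + 1) ^ Suc j" by (simp add: algebra_simps)
    also have "\<dots> = (\<Sum>i\<le>Suc j. of_nat (Suc j choose i) * int x ^ i)"
      by (subst binomial_ring) simp
    finally show ?thesis by simp
  qed
  ultimately have "int q dvd (\<Sum>x<q. \<Sum>i\<le>j. int (Suc j choose i) * int x ^ i)"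
    by simp
  also have "(\<Sum>x<q. \<Sum>i\<le>j. int (Suc j choose i) * int x ^ i)
      = (\<Sum>i\<le>j. int (Suc j choose i) * (\<Sum>x<q. int x ^ i))"
    by (subst sum.swap) (simp add: sum_distrib_left)
  also have "\<dots> = (\<Sum>i<j. int (Suc j choose i) * (\<Sum>x<q. int x ^ i)) + int (Suc j) * (\<Sum>x<q. int x ^ j)"
    by (simp add: lessThan_Suc_atMost[symmetric])
  finally have "int q dvd (\<Sum>i<j. int (Suc j choose i) * (\<Sum>x<q. int x ^ i)) + int (Suc j) * (\<Sum>x<q. int x ^ j)" .
  moreover have "int q dvd (\<Sum>i<j. int (Suc j choose i) * (\<Sum>x<q. int x ^ i))"
    using less by (intro dvd_sum) (auto intro!: dvd_mult)
  ultimately have "int q dvd int (Suc j) * (\<Sum>x<q. int x ^ j)"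
    using dvd_add_right_iff by blast
  moreover have "\<not> int q dvd int (Suc j)"
    using less.prems by (auto dest!: zdvd_imp_le)
  ultimately show ?case using pr prime_dvd_mult_iff by blast
qed

lemma sum_residues_eq:
  fixes g :: "int \<Rightarrow> 'a::comm_monoid_add"
  shows "(\<Sum>x\<in>{0..<int q}. g x) = (\<Sum>x<q. g (int x))"
  by (rule sum.reindex_bij_witness[of _ int nat]) auto

lemma sum_fermat_powers:
  assumes "prime q"
  shows "[(\<Sum>x<q. int x ^ (q - 1)) = -1] (mod int q)"
proof -
  have q: "q > 1" using assms prime_gt_1_nat by blast
  have "(\<Sum>x<q. int x ^ (q - 1)) = (\<Sum>x\<in>{1..<q}. int x ^ (q - 1))"
    using q by (intro sum.mono_neutral_right) auto
  also have "[\<dots> = (\<Sum>x\<in>{1..<q}. 1)] (mod int q)"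
  proof (rule cong_sum)
    fix x assume "x \<in> {1..<q}"
    hence "\<not> q dvd x" by (auto dest: dvd_imp_le)
    from fermat_theorem[OF assms this] have "[int (x ^ (q - 1)) = int 1] (mod int q)"
      using cong_int_iff by blast
    thus "[int x ^ (q - 1) = 1] (mod int q)" by simp
  qed
  also have "(\<Sum>x\<in>{1..<q}. 1::int) = int q - 1" using q by simp
  also have "[int q - 1 = -1] (mod int q)" by (simp add: cong_iff_dvd_diff)
  finally show ?thesis .
qed

text \<open>Among the exponents up to q - 1 only q - 1 itself has a nonvanishing power sum. Summing
  over the field therefore detects whether a polynomial has degree exactly q - 1.\<close>

lemma sum_poly_mod_prime:
  fixes G :: "int poly"
  assumes "prime q" "degree G \<le> q - 1"
  shows "[(\<Sum>x\<in>{0..<int q}. poly G x) = - coeff G (q - 1)] (mod int q)"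
proof -
  have "(\<Sum>x\<in>{0..<int q}. poly G x) = (\<Sum>x<q. \<Sum>i\<le>q - 1. coeff G i * int x ^ i)"
    unfolding sum_residues_eq poly_altdef
    using assms(2) by (intro sum.cong refl sum.mono_neutral_left) (auto simp: coeff_eq_0)
  also have "\<dots> = (\<Sum>i\<le>q - 1. coeff G i * (\<Sum>x<q. int x ^ i))"
    by (subst sum.swap) (simp add: sum_distrib_left)
  also have "\<dots> = (\<Sum>i<q - 1. coeff G i * (\<Sum>x<q. int x ^ i)) + coeff G (q - 1) * (\<Sum>x<q. int x ^ (q - 1))"
    by (simp add: lessThan_Suc_atMost[symmetric])
  also have "[\<dots> = 0 + coeff G (q - 1) * (-1)] (mod int q)"
  proof (intro cong_add cong_mult cong_refl sum_fermat_powers assms(1))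
    show "[(\<Sum>i<q - 1. coeff G i * (\<Sum>x<q. int x ^ i)) = 0] (mod int q)"
      unfolding cong_0_iff using sum_powers_mod_prime[OF assms(1)] by (intro dvd_sum) (auto intro!: dvd_mult)
  qed
  finally show ?thesis by simp
qed

lemma residue_dvd_diff_iff:
  assumes "x \<in> {0..<int q}" "y \<in> {0..<int q}"
  shows "int q dvd x - y \<longleftrightarrow> x = y"
  using assms by (metis atLeastLessThan_iff cong_iff_dvd_diff cong_less_imp_eq_int cong_refl)

text \<open>Lagrange's root bound, kept over the integers: after division by X - r the quotient
  inherits all other roots, since x - r is invertible for a residue x distinct from r. The leading
  coefficient may itself vanish modulo q, so the conclusion concerns every coefficient.\<close>

lemma poly_roots_mod_prime:
  fixes G :: "int poly"
  assumes "prime q" "A \<subseteq> {0..<int q}" "degree G < card A" "\<And>x. x \<in> A \<Longrightarrow> int q dvd poly G x"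
  shows "int q dvd coeff G i"
  using assms(2-)
proof (induction "degree G" arbitrary: G A i)
  case 0
  then obtain x where "x \<in> A" by fastforce
  moreover from 0 obtain c where "G = [:c:]" by (metis degree_eq_zeroE)
  ultimately show ?case using 0 by (cases i) force+
next
  case (Suc n)
  have pr: "prime (int q)" using assms by simp
  have fin: "finite A" using Suc.prems(1) by (rule finite_subset) simp
  obtain r where r: "r \<in> A" using Suc.prems by fastforce
  define Q where "Q = synthetic_div G r"
  have G: "G = [:-r, 1:] * Q + [:poly G r:]"
    using synthetic_div_correct'[of r G] by (simp add: Q_def)
  have deg: "n = degree Q" using Suc.hyps by (simp add: Q_def degree_synthetic_div)
  have c: "int q dvd coeff Q j" for j
  proof (rule Suc.hyps(1)[OF deg, of "A - {r}"])
    show "degree Q < card (A - {r})" using Suc.prems Suc.hyps fin r deg by simp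
    fix x assume x: "x \<in> A - {r}"
    have "poly G x = (x - r) * poly Q x + poly G r"
      by (subst (1) G) (simp add: algebra_simps)
    moreover have "int q dvd poly G x" "int q dvd poly G r" using x r Suc.prems by auto
    ultimately have "int q dvd (x - r) * poly Q x"
      by (metis add_diff_cancel_right' dvd_diff)
    moreover have "\<not> int q dvd x - r"
      using residue_dvd_diff_iff[of x q r] x r Suc.prems(1) by blast
    ultimately show "int q dvd poly Q x" using pr prime_dvd_mult_iff by blast
  qed (use Suc.prems in auto)
  have "int q dvd coeff [:poly G r:] i" using Suc.prems r by (cases i) auto
  moreover have "int q dvd coeff ([:-r, 1:] * Q) i"
    unfolding coeff_mult by (intro dvd_sum dvd_mult c)
  ultimately show ?case by (subst G) (simp only: coeff_add dvd_add)
qed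

lemma power_sum_roots_mod_prime:
  fixes a :: "nat \<Rightarrow> int"
  assumes "prime q" "A \<subseteq> {0..<int q}" "n \<le> card A"
    and "\<And>x. x \<in> A \<Longrightarrow> int q dvd (\<Sum>i<n. a i * x ^ i)" and "i < n"
  shows "int q dvd a i"
proof -
  define G where "G = (\<Sum>i<n. monom (a i) i)"
  have "degree G \<le> n - 1"
    unfolding G_def by (intro degree_sum_le) (auto intro: order.trans[OF degree_monom_le])
  hence "degree G < card A" using assms(3,5) by linarith
  moreover have "poly G x = (\<Sum>i<n. a i * x ^ i)" for x by (simp add: G_def poly_sum poly_monom)
  ultimately have "int q dvd coeff G i" using assms by (intro poly_roots_mod_prime[of q A]) auto
  also have "coeff G i = a i" using assms(5) by (simp add: G_def coeff_sum)
  finally show ?thesis .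
qed

lemma interpolation_mod_prime:
  fixes f :: "int \<Rightarrow> int"
  assumes "prime q"
  obtains G where "degree G \<le> q - 1" "\<And>x. x \<in> {0..<int q} \<Longrightarrow> [poly G x = f x] (mod int q)"
proof
  have q: "q > 1" using assms prime_gt_1_nat by blast
  \<comment> \<open>By Fermat, 1 - (x - y)^(q - 1) is the indicator of x = y modulo q, so this is
    Lagrange interpolation with degree at most q - 1.\<close>
  define G where "G = (\<Sum>y\<in>{0..<int q}. smult (f y) (1 - [:-y, 1:] ^ (q - 1)))"
  have "degree ([:-y, 1:] ^ (q - 1)) = q - 1" for y :: int by (simp add: degree_power_eq)
  thus "degree G \<le> q - 1" unfolding G_def
    by (intro degree_sum_le) (auto intro!: order.trans[OF degree_smult_le] degree_diff_le)
  fix x assume x: "x \<in> {0..<int q}"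
  have "poly G x = (\<Sum>y\<in>{0..<int q}. f y * (1 - (x - y) ^ (q - 1)))"
    by (simp add: G_def poly_sum poly_power)
  also have "[\<dots> = (\<Sum>y\<in>{0..<int q}. if y = x then f x else 0)] (mod int q)"
  proof (rule cong_sum)
    fix y assume y: "y \<in> {0..<int q}"
    show "[f y * (1 - (x - y) ^ (q - 1)) = (if y = x then f x else 0)] (mod int q)"
    proof (cases "y = x")
      case True
      thus ?thesis using q by (simp add: power_0_left)
    next
      case False
      hence "\<not> int q dvd x - y" using residue_dvd_diff_iff[OF x y] by simp
      hence "[(x - y) ^ (q - 1) = 1] (mod int q)"
      proof -
        define z where "z = nat ((x - y) mod int q)"
        have z: "[x - y = int z] (mod int q)" using q by (simp add: z_def cong_def)
        hence "\<not> int q dvd int z" using \<open>\<not> int q dvd x - y\<close> cong_dvd_iff cong_sym by (metis cong_0_iff cong_trans)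
        hence "[int (z ^ (q - 1)) = int 1] (mod int q)"
          using fermat_theorem[OF assms, of z] cong_int_iff by fastforce
        thus ?thesis using cong_pow[OF z, of "q - 1"] by (simp add: cong_trans)
      qed
      hence "int q dvd 1 - (x - y) ^ (q - 1)" by (meson cong_iff_dvd_diff cong_sym)
      thus ?thesis using False by (simp add: cong_0_iff)
    qed
  qed
  also have "(\<Sum>y\<in>{0..<int q}. if y = x then f x else 0) = f x" using x by simp
  finally show "[poly G x = f x] (mod int q)" .
qed

lemma permutation_power_sum_mod_prime:
  fixes g :: "int \<Rightarrow> int"
  assumes "prime q" "inj_on (\<lambda>x. g x mod int q) {0..<int q}" "k < q - 1"
  shows "int q dvd (\<Sum>x\<in>{0..<int q}. g x ^ k)"
proof -
  let ?F = "{0..<int q}"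
  have q: "q > 0" using assms prime_gt_0_nat by blast
  have "(\<lambda>x. g x mod int q) ` ?F = ?F"
    using q by (intro endo_inj_surj assms(2)) auto
  hence "(\<Sum>x\<in>?F. x ^ k) = (\<Sum>x\<in>?F. (g x mod int q) ^ k)"
    using sum.reindex[OF assms(2), of "\<lambda>x. x ^ k"] by simp
  moreover have "[(\<Sum>x\<in>?F. (g x mod int q) ^ k) = (\<Sum>x\<in>?F. g x ^ k)] (mod int q)"
    by (intro cong_sum cong_pow) (simp add: cong_def)
  moreover have "int q dvd (\<Sum>x\<in>?F. x ^ k)"
    unfolding sum_residues_eq using sum_powers_mod_prime[OF assms(1,3)] .
  ultimately show ?thesis using cong_dvd_iff cong_0_iff cong_sym cong_trans by metis
qed

text \<open>For c in \<open>C\<close> the map f x - c x permutes the residues, so the sum of its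
  k-th powers vanishes, where k = i + j. This sum is a polynomial in c with at least as many roots
  as are needed to kill all its coefficients, and the coefficient of c^j is the desired moment up to
  sign and an invertible binomial coefficient.\<close>

lemma mixed_moments_vanish_mod_prime:
  fixes f :: "int \<Rightarrow> int"
  assumes "prime q" "q \<ge> 5" "C \<subseteq> {0..<int q}" "q + 1 \<le> 2 * card C"
    and inj: "\<And>c. c \<in> C \<Longrightarrow> inj_on (\<lambda>x. (f x - c * x) mod int q) {0..<int q}"
    and ij: "2 * (i + j) \<le> q + 1"
  shows "int q dvd (\<Sum>x\<in>{0..<int q}. f x ^ i * x ^ j)"
proof -
  let ?F = "{0..<int q}"
  define k where "k = i + j"
  have pr: "prime (int q)" using assms by simp
  have k: "k < q - 1" "k \<le> card C" using assms by (auto simp: k_def)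
  define a where "a l = (\<Sum>x\<in>?F. int (k choose l) * ((- 1) ^ l * x ^ l) * f x ^ (k - l))" for l
  \<comment> \<open>The coefficient of c^k is a pure power sum and vanishes for every f. This saves
    one root: the k elements guaranteed in \<open>C\<close> are enough for the k remaining
    coefficients.\<close>
  have top: "int q dvd a k"
  proof -
    have "a k = (- 1) ^ k * (\<Sum>x\<in>?F. x ^ k)"
      by (simp add: a_def sum_distrib_left)
    thus ?thesis using sum_powers_mod_prime[OF assms(1) k(1)] by (simp add: sum_residues_eq)
  qed
  have expand: "(\<Sum>x\<in>?F. (f x - c * x) ^ k) = (\<Sum>l<k. a l * c ^ l) + a k * c ^ k" for c
  proof -
    have "(f x - c * x) ^ k = (\<Sum>l\<le>k. int (k choose l) * ((- 1) ^ l * x ^ l) * f x ^ (k - l) * c ^ l)" for x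
    proof -
      have pow: "(- x * c) ^ l = (- 1) ^ l * x ^ l * c ^ l" for l
        by (simp only: power_mult_distrib power_minus[of x])
      have "(f x - c * x) ^ k = ((- x * c) + f x) ^ k" by (simp add: algebra_simps)
      also have "\<dots> = (\<Sum>l\<le>k. of_nat (k choose l) * (- x * c) ^ l * f x ^ (k - l))"
        by (rule binomial_ring)
      finally show ?thesis unfolding pow by (simp only: mult_ac)
    qed
    hence "(\<Sum>x\<in>?F. (f x - c * x) ^ k) = (\<Sum>l\<le>k. a l * c ^ l)"
      by (simp add: a_def sum_distrib_right) (rule sum.swap)
    thus ?thesis by (simp add: lessThan_Suc_atMost[symmetric])
  qed
  have low: "int q dvd a l" if "l < k" for l
  proof (rule power_sum_roots_mod_prime[OF assms(1,3) k(2) _ that])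
    fix c assume "c \<in> C"
    have "int q dvd (\<Sum>l<k. a l * c ^ l) + a k * c ^ k"
      using permutation_power_sum_mod_prime[OF assms(1) inj[OF \<open>c \<in> C\<close>] k(1)] expand by simp
    thus "int q dvd (\<Sum>l<k. a l * c ^ l)" using top by (simp add: dvd_add_left_iff)
  qed
  have "int q dvd a j" using low top by (metis k_def le_add2 le_neq_implies_less)
  also have "a j = int (k choose j) * ((- 1) ^ j * (\<Sum>x\<in>?F. f x ^ i * x ^ j))"
    unfolding a_def k_def by (simp add: sum_distrib_left mult_ac)
  finally have "int q dvd int (k choose j) \<or> int q dvd (- 1) ^ j * (\<Sum>x\<in>?F. f x ^ i * x ^ j)"
    using pr prime_dvd_mult_iff by blast
  moreover have "\<not> int q dvd int (k choose j)"
  proof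
    assume "int q dvd int (k choose j)"
    hence "q dvd (k choose j)" by simp
    hence "q dvd fact k"
      using binomial_fact_lemma[of j k] by (metis dvd_mult k_def le_add2)
    thus False using prime_dvd_fact_iff[OF assms(1)] k by simp
  qed
  ultimately show ?thesis by (cases "even j") auto
qed

text \<open>The prime case of Redei's theorem on directions, by the argument of Lovasz and Schrijver:
  if f had degree d > 1, some product f^a x^b of small total exponent would have
  degree exactly q - 1, so its sum over the field would be nonzero.\<close>
lemma few_directions_imp_affine:
  fixes f :: "int \<Rightarrow> int"
  assumes "prime q" "q \<ge> 5" "C \<subseteq> {0..<int q}" "q + 1 \<le> 2 * card C"
    and inj: "\<And>c. c \<in> C \<Longrightarrow> inj_on (\<lambda>x. (f x - c * x) mod int q) {0..<int q}"
  obtains m n where "\<And>x. x \<in> {0..<int q} \<Longrightarrow> [f x = m * x + n] (mod int q)"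
proof -
  let ?F = "{0..<int q}"
  let ?P = "\<lambda>G :: int poly. \<forall>x\<in>?F. [poly G x = f x] (mod int q)"
  have pr: "prime (int q)" using assms by simp
  obtain G0 where G0: "degree G0 \<le> q - 1" "\<And>x. x \<in> ?F \<Longrightarrow> [poly G0 x = f x] (mod int q)"
    using interpolation_mod_prime[OF assms(1), where f = f] by metis
  hence PG0: "?P G0" by blast
  \<comment> \<open>Minimal degree ensures that the leading coefficient is a unit modulo q:
    otherwise the leading term could be dropped without changing the values.\<close>
  define G where "G = arg_min degree ?P"
  have G: "?P G" and min: "\<And>H. ?P H \<Longrightarrow> degree G \<le> degree H"
    unfolding G_def by (rule arg_min_natI[of ?P, OF PG0], rule arg_min_nat_le)
  define d where "d = degree G"
  have dq: "d \<le> q - 1" using min[OF PG0] G0(1) by (simp add: d_def)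
  have "d \<le> 1"
  proof (rule ccontr)
    assume "\<not> d \<le> 1"
    hence d2: "d \<ge> 2" by simp
    hence "G \<noteq> 0" by (auto simp: d_def)
    have lc: "\<not> int q dvd lead_coeff G"
    proof
      assume dvd: "int q dvd lead_coeff G"
      define H where "H = G - monom (lead_coeff G) d"
      have "?P H"
      proof
        fix x assume "x \<in> ?F"
        have "[poly G x - lead_coeff G * x ^ d = f x - 0] (mod int q)"
          using G \<open>x \<in> ?F\<close> dvd by (intro cong_diff) (auto simp: cong_0_iff)
        thus "[poly H x = f x] (mod int q)" by (simp add: H_def poly_monom)
      qed
      hence "d \<le> degree H" using min by (simp add: d_def)
      moreover have "degree H \<le> d" unfolding H_def
        by (intro degree_diff_le) (auto simp: d_def intro: degree_monom_le)
      moreover have "coeff H d = 0" by (simp add: H_def d_def)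
      ultimately show False using d2 by (metis degree_0 le_antisym leading_coeff_0_iff not_numeral_le_zero)
    qed
    have no: False if "a * d + b = q - 1" "2 * (a + b) \<le> q + 1" for a b
    proof -
      define H where "H = G ^ a * monom 1 b"
      have "degree H = q - 1" using that \<open>G \<noteq> 0\<close>
        by (simp add: H_def degree_mult_eq degree_power_eq d_def degree_monom_eq)
      moreover have "lead_coeff H = lead_coeff G ^ a"
        by (simp only: H_def lead_coeff_mult lead_coeff_power lead_coeff_monom mult_1_right)
      ultimately have "[(\<Sum>x\<in>?F. poly H x) = - (lead_coeff G ^ a)] (mod int q)"
        using sum_poly_mod_prime[OF assms(1), of H] by simp
      moreover have "[(\<Sum>x\<in>?F. poly H x) = (\<Sum>x\<in>?F. f x ^ a * x ^ b)] (mod int q)"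
        using G by (intro cong_sum) (auto simp: H_def poly_power poly_monom intro!: cong_mult cong_pow)
      moreover have "[(\<Sum>x\<in>?F. f x ^ a * x ^ b) = 0] (mod int q)"
        unfolding cong_0_iff by (rule mixed_moments_vanish_mod_prime[OF assms that(2)])
      ultimately have "[- (lead_coeff G ^ a) = 0] (mod int q)"
        using cong_sym cong_trans by blast
      hence "int q dvd lead_coeff G ^ a" by (simp add: cong_0_iff)
      thus False using lc pr prime_dvd_power by blast
    qed
    show False
    \<comment> \<open>The exponents must satisfy a d + b = q - 1 with a + b at most (q + 1)/2. If d
      is at least (q - 1)/2, the choice a = 1 works; otherwise division of q - 1 by d gives a
      quotient of at least 2.\<close>
    proof (cases "q \<le> 2 * d + 1")
      case True
      obtain e where "q - 1 = d + e" using dq le_Suc_ex by blast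
      moreover from this have "q = d + e + 1" using assms(2) by simp
      hence "2 * (1 + e) \<le> q + 1" using True by simp
      ultimately show False using no[of 1 e] by simp
    next
      case False
      define a b where "a = (q - 1) div d" and "b = (q - 1) mod d"
      have ab: "a * d + b = q - 1" by (simp add: a_def b_def)
      have "b < d" using d2 by (simp add: b_def)
      have "2 * d div d \<le> (q - 1) div d" using False by (intro div_le_mono) simp
      hence "a \<ge> 2" using d2 by (simp add: a_def)
      \<comment> \<open>With d = e + 2 the required bound becomes b \<le> a e + 2, which follows
        from a \<ge> 2 and b \<le> e + 1.\<close>
      obtain e where e: "d = e + 2" using d2 le_Suc_ex by (metis add.commute)
      have "2 * e \<le> a * e" using \<open>a \<ge> 2\<close> by simp
      moreover have "q = a * e + 2 * a + b + 1" using ab assms(2) by (simp add: e algebra_simps)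
      moreover have "b \<le> e + 1" using \<open>b < d\<close> e by simp
      ultimately have "2 * (a + b) \<le> q + 1" unfolding distrib_left by linarith
      thus False using no ab by blast
    qed
  qed
  hence "poly G x = coeff G 1 * x + coeff G 0" for x
    unfolding poly_altdef d_def[symmetric] by (cases d) (auto simp: algebra_simps d_def coeff_eq_0)
  thus thesis using that[of "coeff G 1" "coeff G 0"] G by (metis cong_sym)
qed

section \<open>Automorphisms are affine\<close>

lemma additive_mod_imp_linear:
  fixes g :: "int \<Rightarrow> int"
  assumes "\<And>x y. [g (x + y) = g x + g y] (mod m)"
  shows "[g x = x * g 1] (mod m)"
proof -
  have g0: "[g 0 = 0] (mod m)" using assms[of 0 0] by (simp add: cong_iff_dvd_diff)
  have nat: "[g (int n) = int n * g 1] (mod m)" for n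
  proof (induction n)
    case (Suc n)
    have "[g (int n + 1) = g (int n) + g 1] (mod m)" by (rule assms)
    also have "[g (int n) + g 1 = int n * g 1 + g 1] (mod m)" by (intro cong_add Suc.IH cong_refl)
    finally show ?case by (simp add: algebra_simps)
  qed (use g0 in simp)
  show ?thesis
  proof (cases "x \<ge> 0")
    case True
    thus ?thesis using nat[of "nat x"] by simp
  next
    case False
    have "[g 0 = g x + g (- x)] (mod m)" using assms[of x "- x"] by simp
    moreover have "[g (- x) = - x * g 1] (mod m)" using nat[of "nat (- x)"] False by simp
    ultimately have "m dvd g 0 - (g x + g (- x))" "m dvd g (- x) - (- x * g 1)" "m dvd g 0"
      using g0 by (simp_all add: cong_iff_dvd_diff)
    moreover have "g x - x * g 1 = g 0 - (g 0 - (g x + g (- x))) - (g (- x) - (- x * g 1))" by simp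
    ultimately have "m dvd g x - x * g 1" by (metis dvd_diff)
    thus ?thesis by (simp add: cong_iff_dvd_diff)
  qed
qed

lemma inverse_mod_prime:
  assumes "prime q" "\<not> int q dvd a"
  obtains k where "[a * k = 1] (mod int q)"
proof -
  have "coprime (int q) a" using assms by (intro prime_imp_coprime) auto
  thus thesis using that cong_solve_coprime_int[of a "int q"] coprime_commute by blast
qed

text \<open>The hypotheses say that (X, Y) carries the lines of slope s1, s2, s3 to lines of slope
  t1, t2, t3. The third offset is a combination of the first two, both before and after the map,
  and this forces the third offset function to satisfy Cauchy's functional equation.\<close>
lemma three_parallel_classes_affine:
  fixes X Y :: "int \<Rightarrow> int \<Rightarrow> int" and \<psi>1 \<psi>2 \<psi>3 :: "int \<Rightarrow> int"
  assumes "prime q" "\<not> int q dvd s1 - s3" "\<not> int q dvd s2 - s3" "\<not> int q dvd t1 - t2"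
    and 1: "\<And>x y. [Y x y = t1 * X x y + \<psi>1 ((y - s1 * x) mod int q)] (mod int q)"
    and 2: "\<And>x y. [Y x y = t2 * X x y + \<psi>2 ((y - s2 * x) mod int q)] (mod int q)"
    and 3: "\<And>x y. [Y x y = t3 * X x y + \<psi>3 ((y - s3 * x) mod int q)] (mod int q)"
  obtains m n where "\<And>z. [\<psi>3 (z mod int q) = m * z + n] (mod int q)"
proof -
  have pr: "prime (int q)" using assms by simp
  obtain k1 where k1: "[(s1 - s3) * k1 = 1] (mod int q)" using inverse_mod_prime assms by blast
  obtain k2 where k2: "[(s2 - s3) * k2 = 1] (mod int q)" using inverse_mod_prime assms by blast
  define h where "h z = \<psi>3 (z mod int q)" for z
  \<comment> \<open>The coefficients t2 - t3, t3 - t1, t1 - t2 have sum zero, and so do their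
    products with t1, t2, t3 respectively. The combination thus eliminates both \<open>Y\<close> and
    \<open>X\<close>.\<close>
  have rel: "int q dvd (t2 - t3) * \<psi>1 ((y - s1 * x) mod int q) + (t3 - t1) * \<psi>2 ((y - s2 * x) mod int q)
       + (t1 - t2) * h z" if "[y - s3 * x = z] (mod int q)" for x y z
  proof -
    let ?a = "\<psi>1 ((y - s1 * x) mod int q)" and ?b = "\<psi>2 ((y - s2 * x) mod int q)"
      and ?c = "\<psi>3 ((y - s3 * x) mod int q)"
    have "int q dvd (t2 - t3) * (Y x y - (t1 * X x y + ?a)) + (t3 - t1) * (Y x y - (t2 * X x y + ?b))
       + (t1 - t2) * (Y x y - (t3 * X x y + ?c))"
      using 1[of x y] 2[of x y] 3[of x y] unfolding cong_iff_dvd_diff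
      by (intro dvd_add dvd_mult)
    also have "\<dots> = - ((t2 - t3) * ?a + (t3 - t1) * ?b + (t1 - t2) * ?c)"
      by (simp add: algebra_simps)
    also have "?c = h z" using that by (simp add: h_def cong_def)
    finally show ?thesis by (simp only: dvd_minus_iff)
  qed
  have add: "[h (z + w) + h 0 = h z + h w] (mod int q)" for z w
  proof -
    \<comment> \<open>The points P = (x, s1 x) and P' = (x', s2 x') have s3-offsets z and w. In the
      parallelogram 0, P, P + P', P' the point P + P' shares its s1-offset with P' and its s2-offset
      with P, so an alternating sum of \<open>rel\<close> over the corners leaves only values of
      \<open>h\<close>.\<close>
    define x x' where "x = k1 * z" and "x' = k2 * w"
    have z: "[s1 * x - s3 * x = z] (mod int q)"
      using cong_mult[OF k1 cong_refl[of z]] by (simp add: x_def algebra_simps)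
    have w: "[s2 * x' - s3 * x' = w] (mod int q)"
      using cong_mult[OF k2 cong_refl[of w]] by (simp add: x'_def algebra_simps)
    have zw: "[(s1 * x + s2 * x') - s3 * (x + x') = z + w] (mod int q)"
      using cong_add[OF z w] by (simp add: algebra_simps)
    define u where "u = \<psi>1 ((s2 * x' - s1 * x') mod int q)"
    define v where "v = \<psi>2 ((s1 * x - s2 * x) mod int q)"
    have a: "int q dvd (t2 - t3) * u + (t3 - t1) * v + (t1 - t2) * h (z + w)"
      using rel[OF zw] by (simp add: u_def v_def algebra_simps)
    have b: "int q dvd (t2 - t3) * \<psi>1 0 + (t3 - t1) * v + (t1 - t2) * h z"
      using rel[OF z] by (simp add: v_def)
    have c: "int q dvd (t2 - t3) * u + (t3 - t1) * \<psi>2 0 + (t1 - t2) * h w"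
      using rel[OF w] by (simp add: u_def)
    have d: "int q dvd (t2 - t3) * \<psi>1 0 + (t3 - t1) * \<psi>2 0 + (t1 - t2) * h 0"
      using rel[of 0 0 0] by simp
    have "int q dvd (t1 - t2) * (h (z + w) + h 0 - (h z + h w))"
      using dvd_diff[OF dvd_add[OF a d] dvd_add[OF b c]] by (simp add: algebra_simps)
    thus ?thesis using assms(4) pr by (simp add: prime_dvd_mult_iff cong_iff_dvd_diff)
  qed
  have "[h (x + y) - h 0 = (h x - h 0) + (h y - h 0)] (mod int q)" for x y
    using add[of x y] by (simp add: cong_iff_dvd_diff algebra_simps)
  from additive_mod_imp_linear[of "\<lambda>z. h z - h 0", OF this]
  have "[h z = (h 1 - h 0) * z + h 0] (mod int q)" for z
    by (simp add: cong_iff_dvd_diff algebra_simps)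
  thus thesis using that unfolding h_def by blast
qed

section \<open>Adjacency as a congruence; lines, cliques and their images\<close>

lemma verts_eq: "verts q = {0..<int q} \<times> {0..<int q}"
  by (auto simp: verts_def residue_ring_def)

text \<open>Cross-multiplication turns the quotient in the residue ring into an integer congruence.
  As S consists of reduced residues, a slope congruent to the quotient is equal to it.\<close>

lemma adjS_iff:
  assumes "prime q" "S \<subseteq> {0..<int q}" "u \<in> verts q" "v \<in> verts q"
  shows "adjS q S u v \<longleftrightarrow> fst u \<noteq> fst v \<and>
    (\<exists>s\<in>S. [snd v - snd u = s * (fst v - fst u)] (mod int q))"
proof (cases "fst u = fst v")
  case True
  thus ?thesis by (simp add: adjS_def)
next
  case False
  have pr: "prime (int q)" using assms by simp
  interpret residues_prime q "Fq q" using assms(1) by unfold_locales simp_all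
  have carrier: "carrier (Fq q) = {0..<int q}" by (auto simp: residue_ring_def)
  have minus: "a \<ominus>\<^bsub>Fq q\<^esub> b = (a - b) mod int q" for a b
    by (simp add: a_minus_def res_add_eq res_neg_eq mod_simps)
  define w where "w = fst v \<ominus>\<^bsub>Fq q\<^esub> fst u"
  have wq: "[w = fst v - fst u] (mod int q)" by (simp add: w_def minus cong_def)
  have uv: "\<not> int q dvd fst v - fst u"
    using residue_dvd_diff_iff[of "fst v" q "fst u"] False assms by (auto simp: verts_eq)
  hence "w \<noteq> 0" by (auto simp: w_def minus)
  moreover have "w \<in> carrier (Fq q)" using assms(1) prime_gt_0_nat by (auto simp: w_def minus carrier)
  ultimately have w: "w \<in> Units (Fq q)" using field_Units by (auto simp: res_zero_eq)
  define t where "t = (snd v \<ominus>\<^bsub>Fq q\<^esub> snd u) \<otimes>\<^bsub>Fq q\<^esub> inv\<^bsub>Fq q\<^esub> w"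
  have c: "(snd v \<ominus>\<^bsub>Fq q\<^esub> snd u) \<in> carrier (Fq q)"
    using assms(1) prime_gt_0_nat by (auto simp: minus carrier)
  have t: "t \<in> {0..<int q}" using c w unfolding t_def carrier[symmetric] by simp
  have "t \<otimes>\<^bsub>Fq q\<^esub> w = snd v \<ominus>\<^bsub>Fq q\<^esub> snd u"
    unfolding t_def using c w by (metis Units_closed Units_inv_closed Units_l_inv m_assoc r_one)
  hence "[t * w = snd v - snd u] (mod int q)" by (simp add: res_mult_eq minus cong_def)
  hence t': "[snd v - snd u = t * (fst v - fst u)] (mod int q)"
    using cong_mult[OF cong_refl wq] cong_sym cong_trans by blast
  have "s = t" if "s \<in> S" "[snd v - snd u = s * (fst v - fst u)] (mod int q)" for s
  proof -
    have "[s * (fst v - fst u) = t * (fst v - fst u)] (mod int q)"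
      using that t' cong_sym cong_trans by blast
    hence "int q dvd (s - t) * (fst v - fst u)" by (simp add: cong_iff_dvd_diff algebra_simps)
    hence "int q dvd s - t" using uv pr prime_dvd_mult_iff by blast
    thus ?thesis using residue_dvd_diff_iff[of s q t] t that assms(2) by auto
  qed
  moreover have "adjS q S u v \<longleftrightarrow> t \<in> S" using False by (simp add: adjS_def t_def w_def)
  ultimately show ?thesis using False t' by blast
qed

text \<open>The bound q \<ge> 7 gives S at least three elements, hence the three parallel classes
  needed for affinity; finitely many primes do not affect the limit.\<close>

locale slope_graph =
  fixes q :: nat and S :: "int set"
  assumes prime_q: "prime q" and q_ge: "q \<ge> 7"
    and S_sub: "S \<subseteq> {0..<int q}" and card_S: "card S = (q - 1) div 2"
begin

abbreviation F :: "int set" where "F \<equiv> {0..<int q}"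

definition line :: "int \<Rightarrow> int \<Rightarrow> (int \<times> int) set" where
  "line s c = {v \<in> verts q. [snd v = s * fst v + c] (mod int q)}"

lemma prime_int_q: "prime (int q)" using prime_q by simp

lemma residue_cong_iff: "x \<in> F \<Longrightarrow> y \<in> F \<Longrightarrow> [x = y] (mod int q) \<longleftrightarrow> x = y"
  using residue_dvd_diff_iff by (simp add: cong_iff_dvd_diff)

lemma mod_in_F [simp]: "x mod int q \<in> F"
  using q_ge by simp

lemma adj_iff:
  "u \<in> verts q \<Longrightarrow> v \<in> verts q \<Longrightarrow> adjS q S u v \<longleftrightarrow> fst u \<noteq> fst v \<and>
    (\<exists>s\<in>S. [snd v - snd u = s * (fst v - fst u)] (mod int q))"
  by (rule adjS_iff[OF prime_q S_sub])

lemma line_eq_image: "line s c = (\<lambda>x. (x, (s * x + c) mod int q)) ` F"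
proof -
  have "y = (s * x + c) mod int q" if "y \<in> F" "[y = s * x + c] (mod int q)" for x y
    using that by (metis cong_def mod_in_F residue_cong_iff cong_mod_right)
  thus ?thesis by (force simp: line_def verts_eq cong_def)
qed

lemma card_line: "card (line s c) = q"
  unfolding line_eq_image by (subst card_image) (auto simp: inj_on_def)

lemma line_subset_verts: "line s c \<subseteq> verts q"
  by (auto simp: line_def)

lemma line_cong: "[c = c'] (mod int q) \<Longrightarrow> line s c = line s c'"
  unfolding line_eq_image by (metis cong_add_lcancel cong_def)

lemma same_fst_on_line:
  assumes "u \<in> line s c" "v \<in> line s c" "fst u = fst v"
  shows "u = v"
  using assms unfolding line_eq_image by auto

lemma line_clique:
  assumes "s \<in> S" "u \<in> line s c" "v \<in> line s c" "u \<noteq> v"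
  shows "adjS q S u v"
proof -
  have "fst u \<noteq> fst v" using assms same_fst_on_line by blast
  moreover have "[snd v - snd u = (s * fst v + c) - (s * fst u + c)] (mod int q)"
    using assms by (intro cong_diff) (auto simp: line_def)
  ultimately show ?thesis using assms line_subset_verts
    by (subst adj_iff) (auto simp: algebra_simps)
qed

lemma clique_is_line:
  assumes U: "U \<subseteq> verts q" "card U = q"
    and adj: "\<And>u v. u \<in> U \<Longrightarrow> v \<in> U \<Longrightarrow> u \<noteq> v \<Longrightarrow> adjS q S u v"
  shows "\<exists>s\<in>S. \<exists>c. U = line s c"
proof -
  have inj: "inj_on fst U"
  proof (rule inj_onI, rule ccontr)
    fix u v assume "u \<in> U" "v \<in> U" "fst u = fst v" "u \<noteq> v"
    thus False using adj[of u v] by (simp add: adjS_def)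
  qed
  have "fst ` U = F"
  proof (rule card_subset_eq)
    show "fst ` U \<subseteq> F" using U by (auto simp: verts_eq)
    show "card (fst ` U) = card F" using card_image[OF inj] U by simp
  qed simp
  define f where "f x = snd (the_inv_into U fst x)" for x
  have inU: "(x, f x) \<in> U" if "x \<in> F" for x
  proof -
    have x: "x \<in> fst ` U" using that \<open>fst ` U = F\<close> by simp
    hence "the_inv_into U fst x \<in> U" using the_inv_into_into[OF inj] by blast
    moreover have "fst (the_inv_into U fst x) = x" using f_the_inv_into_f[OF inj x] .
    ultimately show ?thesis by (metis f_def prod.collapse)
  qed
  have slope: "\<exists>s\<in>S. [f y - f x = s * (y - x)] (mod int q)" if "x \<in> F" "y \<in> F" "x \<noteq> y" for x y
  proof -
    have "adjS q S (x, f x) (y, f y)" using that inU adj by blast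
    thus ?thesis using inU that U by (subst (asm) adj_iff) auto
  qed
  \<comment> \<open>For odd q this is (q + 1)/2, exactly the least size allowed for the set of
    non-directions.\<close>
  have card: "card (F - S) = q - (q - 1) div 2"
    using card_Diff_subset[of S F] S_sub card_S finite_subset by fastforce
  obtain m n where mn: "\<And>x. x \<in> F \<Longrightarrow> [f x = m * x + n] (mod int q)"
  proof (rule few_directions_imp_affine[OF prime_q, of "F - S" f])
    show "5 \<le> q" using q_ge by simp
    show "q + 1 \<le> 2 * card (F - S)" unfolding card using q_ge by presburger
  next
    fix c assume c: "c \<in> F - S"
    show "inj_on (\<lambda>x. (f x - c * x) mod int q) F"
    proof (rule inj_onI, rule ccontr)
      fix x y assume x: "x \<in> F" and y: "y \<in> F" and "x \<noteq> y"
        and eq: "(f x - c * x) mod int q = (f y - c * y) mod int q"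
      then obtain s where s: "s \<in> S" "[f y - f x = s * (y - x)] (mod int q)" using slope by blast
      have "int q dvd (f y - c * y) - (f x - c * x)" using eq by (metis cong_def cong_iff_dvd_diff)
      moreover have "int q dvd (f y - f x) - s * (y - x)" using s by (simp add: cong_iff_dvd_diff)
      ultimately have "int q dvd ((f y - c * y) - (f x - c * x)) - ((f y - f x) - s * (y - x))"
        by (rule dvd_diff)
      hence "int q dvd (s - c) * (y - x)" by (simp add: algebra_simps)
      moreover have "\<not> int q dvd y - x" using residue_dvd_diff_iff x y \<open>x \<noteq> y\<close> by blast
      ultimately have "int q dvd s - c" using prime_int_q prime_dvd_mult_iff by blast
      thus False using residue_dvd_diff_iff[of s q c] s c S_sub by blast
    qed
  qed (use that in auto)
  \<comment> \<open>The slope m is so far just some integer; the secant through 0 and 1 identifies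
    its class with an element of S.\<close>
  obtain s where s: "s \<in> S" "[f 1 - f 0 = s * (1 - 0)] (mod int q)"
    using slope[of 0 1] q_ge by auto
  have "[f 1 - f 0 = (m * 1 + n) - (m * 0 + n)] (mod int q)"
    using q_ge by (intro cong_diff mn) auto
  hence sm: "[m = s] (mod int q)" using s(2) by (simp add: cong_def)
  have "line s n \<subseteq> U"
  proof
    fix v assume "v \<in> line s n"
    then obtain x where x: "x \<in> F" "v = (x, (s * x + n) mod int q)" unfolding line_eq_image by blast
    have "[f x = m * x + n] (mod int q)" using mn x by blast
    also have "[m * x + n = s * x + n] (mod int q)" by (intro cong_add cong_mult cong_refl sm)
    finally have "f x mod int q = (s * x + n) mod int q" by (simp add: cong_def)
    moreover have "f x \<in> F" using inU[OF x(1)] U by (auto simp: verts_eq)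
    ultimately show "v \<in> U" using x inU[OF x(1)] by simp
  qed
  moreover have "finite U" using U q_ge card.infinite by fastforce
  ultimately have "line s n = U" using U card_line by (intro card_subset_eq) auto
  thus ?thesis using s by blast
qed

lemma lines_meet:
  assumes "s \<in> F" "t \<in> F" "s \<noteq> t"
  shows "line s c \<inter> line t e \<noteq> {}"
proof -
  have "\<not> int q dvd s - t" using assms residue_dvd_diff_iff by blast
  then obtain k where k: "[(s - t) * k = 1] (mod int q)" using inverse_mod_prime[OF prime_q] by blast
  define x where "x = (k * (e - c)) mod int q"
  have "[(s - t) * x = (s - t) * k * (e - c)] (mod int q)"
    by (simp add: x_def cong_def mod_mult_right_eq mult.assoc)
  also have "[(s - t) * k * (e - c) = 1 * (e - c)] (mod int q)" by (intro cong_mult k cong_refl)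
  finally have "[s * x + c = t * x + e] (mod int q)" by (simp add: cong_iff_dvd_diff algebra_simps)
  moreover have "x \<in> F" unfolding x_def by (rule mod_in_F)
  ultimately have "(x, (s * x + c) mod int q) \<in> line s c \<inter> line t e"
    unfolding line_eq_image by (auto simp: cong_def)
  thus ?thesis by blast
qed

lemma aut_maps_lines:
  assumes f: "f \<in> AutG q S" and s: "s \<in> S"
  shows "\<exists>t\<in>S. \<exists>e. f ` line s c = line t e"
proof (rule clique_is_line)
  have bij: "bij_betw f (verts q) (verts q)" using f by (simp add: AutG_def)
  hence inj: "inj_on f (line s c)" by (meson bij_betw_imp_inj_on inj_on_subset line_subset_verts)
  show "f ` line s c \<subseteq> verts q" using bij line_subset_verts by (metis bij_betw_imp_surj_on image_mono)
  show "card (f ` line s c) = q" using card_image[OF inj] card_line by simp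
  fix u v assume "u \<in> f ` line s c" "v \<in> f ` line s c" "u \<noteq> v"
  then obtain u' v' where uv: "u' \<in> line s c" "v' \<in> line s c" "u = f u'" "v = f v'" "u' \<noteq> v'" by blast
  hence "adjS q S u' v'" using line_clique s by blast
  moreover have "u' \<in> verts q" "v' \<in> verts q" using uv line_subset_verts by auto
  ultimately show "adjS q S u v" using f uv by (simp add: AutG_def)
qed

text \<open>Distinct parallel lines are disjoint and so are their images, whereas lines of different
  slopes meet; hence parallel lines have parallel images. Distinct slopes stay distinct because two
  lines through (0, 0) with parallel images would have the same image.\<close>

lemma aut_permutes_slopes:
  assumes f: "f \<in> AutG q S"
  obtains \<sigma> \<epsilon> where "inj_on \<sigma> S" "\<And>s. s \<in> S \<Longrightarrow> \<sigma> s \<in> S"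
    "\<And>s c. s \<in> S \<Longrightarrow> f ` line s c = line (\<sigma> s) (\<epsilon> s c)"
proof -
  have inj: "inj_on f (verts q)" using f by (simp add: AutG_def bij_betw_def)
  have "\<exists>t\<in>S. \<forall>c. \<exists>e. f ` line s c = line t e" if s: "s \<in> S" for s
  proof -
    obtain t e where t: "t \<in> S" "f ` line s 0 = line t e" using aut_maps_lines[OF f s] by blast
    have "\<exists>e. f ` line s c = line t e" for c
    proof (cases "line s c = line s 0")
      case True
      thus ?thesis using t by auto
    next
      case False
      obtain t' e' where t': "t' \<in> S" "f ` line s c = line t' e'" using aut_maps_lines[OF f s] by blast
      have "t' = t"
      proof (rule ccontr)
        assume "t' \<noteq> t"
        then obtain w where "w \<in> f ` line s c" "w \<in> f ` line s 0"
          using lines_meet[of t' t e' e] t t' S_sub by blast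
        then obtain v v' where vv: "v \<in> line s c" "v' \<in> line s 0" "f v = f v'" by auto
        moreover from this have "v = v'" using inj line_subset_verts by (meson inj_onD subsetD)
        ultimately have v: "v \<in> line s c" "v \<in> line s 0" by auto
        hence "[s * fst v + c = s * fst v + 0] (mod int q)"
          using cong_sym cong_trans unfolding line_def by blast
        hence "line s c = line s 0" by (intro line_cong) (simp only: cong_add_lcancel)
        thus False using False by blast
      qed
      thus ?thesis using t' by blast
    qed
    thus ?thesis using t by blast
  qed
  then obtain \<sigma> where \<sigma>: "\<And>s. s \<in> S \<Longrightarrow> \<sigma> s \<in> S" "\<And>s c. s \<in> S \<Longrightarrow> \<exists>e. f ` line s c = line (\<sigma> s) e"
    by metis
  then obtain \<epsilon> where \<epsilon>: "\<And>s c. s \<in> S \<Longrightarrow> f ` line s c = line (\<sigma> s) (\<epsilon> s c)" by metis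
  have "inj_on \<sigma> S"
  proof (rule inj_onI)
    fix s t assume s: "s \<in> S" and t: "t \<in> S" and eq: "\<sigma> s = \<sigma> t"
    have "(0, 0) \<in> line s 0" "(0, 0) \<in> line t 0" using q_ge by (auto simp: line_def verts_eq)
    hence "f (0, 0) \<in> line (\<sigma> t) (\<epsilon> s 0)" "f (0, 0) \<in> line (\<sigma> t) (\<epsilon> t 0)"
      using \<epsilon>[OF s, of 0] \<epsilon>[OF t, of 0] eq by auto
    hence "[\<sigma> t * fst (f (0, 0)) + \<epsilon> s 0 = \<sigma> t * fst (f (0, 0)) + \<epsilon> t 0] (mod int q)"
      using cong_sym cong_trans unfolding line_def by blast
    hence "line (\<sigma> t) (\<epsilon> s 0) = line (\<sigma> t) (\<epsilon> t 0)" by (intro line_cong) (simp only: cong_add_lcancel)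
    hence "f ` line s 0 = f ` line t 0" using \<epsilon> s t eq by simp
    hence "line s 0 = line t 0"
      using inj_on_image_eq_iff[OF inj line_subset_verts line_subset_verts] by simp
    moreover have "(1, s) \<in> line s 0" using q_ge s S_sub by (auto simp: line_def verts_eq)
    ultimately have "[s = t] (mod int q)" by (simp add: line_def)
    thus "s = t" using residue_cong_iff s t S_sub by blast
  qed
  thus thesis using \<sigma>(1) \<epsilon> by (rule that)
qed

text \<open>Once the offset maps of two slopes s1 and s2 are known to be affine, the image point is
  the intersection of two lines of different slopes with offsets affine in x and y. Solving this
  linear system gives both coordinates.\<close>

lemma aut_is_affine:
  assumes f: "f \<in> AutG q S"
  obtains a b c d e1 e2 where
    "\<And>x y. x \<in> F \<Longrightarrow> y \<in> F \<Longrightarrow> [fst (f (x, y)) = a * x + b * y + e1] (mod int q)"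
    "\<And>x y. x \<in> F \<Longrightarrow> y \<in> F \<Longrightarrow> [snd (f (x, y)) = c * x + d * y + e2] (mod int q)"
proof -
  obtain \<sigma> \<epsilon> where inj: "inj_on \<sigma> S" and \<sigma>: "\<And>s. s \<in> S \<Longrightarrow> \<sigma> s \<in> S"
    and \<epsilon>: "\<And>s c. s \<in> S \<Longrightarrow> f ` line s c = line (\<sigma> s) (\<epsilon> s c)"
    using aut_permutes_slopes[OF f] by blast
  \<comment> \<open>The coordinates of \<open>f\<close> are extended periodically to all integers,
    over which the functional equation is posed.\<close>
  define X Y where "X x y = fst (f (x mod int q, y mod int q))"
    and "Y x y = snd (f (x mod int q, y mod int q))" for x y
  have rel: "[Y x y = \<sigma> s * X x y + \<epsilon> s ((y - s * x) mod int q)] (mod int q)" if "s \<in> S" for s x y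
  proof -
    have "[s * (x mod int q) + (y - s * x) mod int q = s * x + (y - s * x)] (mod int q)"
      by (intro cong_add cong_mult cong_refl) (simp_all add: cong_def)
    hence "[y = s * (x mod int q) + (y - s * x) mod int q] (mod int q)"
      by (simp add: cong_sym)
    hence "(x mod int q, y mod int q) \<in> line s ((y - s * x) mod int q)"
      using q_ge by (simp add: line_def verts_eq)
    hence "f (x mod int q, y mod int q) \<in> line (\<sigma> s) (\<epsilon> s ((y - s * x) mod int q))"
      using \<epsilon>[OF that] by blast
    thus ?thesis by (simp add: line_def X_def Y_def)
  qed
  have "3 \<le> card S" using card_S q_ge by simp
  then obtain T where "T \<subseteq> S" "card T = 3" by (meson obtain_subset_with_card_n)
  then obtain s1 s2 s3 where s: "s1 \<in> S" "s2 \<in> S" "s3 \<in> S" and ne: "s1 \<noteq> s2" "s1 \<noteq> s3" "s2 \<noteq> s3"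
    unfolding card_3_iff by auto
  have nd: "\<not> int q dvd s - t" "\<not> int q dvd \<sigma> s - \<sigma> t" if "s \<in> S" "t \<in> S" "s \<noteq> t" for s t
  proof -
    show "\<not> int q dvd s - t" using residue_dvd_diff_iff that S_sub by blast
    have "\<sigma> s \<noteq> \<sigma> t" using inj that by (auto dest: inj_onD)
    thus "\<not> int q dvd \<sigma> s - \<sigma> t" using residue_dvd_diff_iff[of "\<sigma> s" q "\<sigma> t"] \<sigma> that S_sub by blast
  qed
  have lin: "\<exists>m n. \<forall>z. [\<epsilon> s (z mod int q) = m * z + n] (mod int q)"
 if *: "s \<in> S" "t \<in> S" "r \<in> S" "t \<noteq> s" "r \<noteq> s" "t \<noteq> r" for s t r
  proof -
    obtain m n where "\<And>z. [\<epsilon> s (z mod int q) = m * z + n] (mod int q)"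
    proof (rule three_parallel_classes_affine[where q = q and X = X and Y = Y and ?s1.0 = t
          and ?s2.0 = r and ?s3.0 = s and ?t1.0 = "\<sigma> t" and ?t2.0 = "\<sigma> r" and ?t3.0 = "\<sigma> s"
          and ?\<psi>1.0 = "\<epsilon> t" and ?\<psi>2.0 = "\<epsilon> r" and ?\<psi>3.0 = "\<epsilon> s"])
    qed (use * nd rel prime_q in auto)
    thus ?thesis by blast
  qed
  obtain m1 n1 where 1: "\<And>z. [\<epsilon> s1 (z mod int q) = m1 * z + n1] (mod int q)"
    using lin[OF s] ne by metis
  obtain m2 n2 where 2: "\<And>z. [\<epsilon> s2 (z mod int q) = m2 * z + n2] (mod int q)"
    using lin[OF s(2,1,3)] ne by metis
  obtain k where k: "[(\<sigma> s1 - \<sigma> s2) * k = 1] (mod int q)"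
    using inverse_mod_prime[OF prime_q nd(2)[OF s(1,2) ne(1)]] by blast
  define L1 L2 where "L1 x y = m1 * (y - s1 * x) + n1" and "L2 x y = m2 * (y - s2 * x) + n2" for x y
  have Y1: "[Y x y = \<sigma> s1 * X x y + L1 x y] (mod int q)" for x y
    using cong_trans[OF rel[OF s(1)] cong_add[OF cong_refl 1]] by (simp add: L1_def)
  have Y2: "[Y x y = \<sigma> s2 * X x y + L2 x y] (mod int q)" for x y
    using cong_trans[OF rel[OF s(2)] cong_add[OF cong_refl 2]] by (simp add: L2_def)
  have X: "[X x y = k * (L2 x y - L1 x y)] (mod int q)" for x y
  proof -
    have "int q dvd (Y x y - (\<sigma> s1 * X x y + L1 x y)) - (Y x y - (\<sigma> s2 * X x y + L2 x y))"
      using Y1 Y2 unfolding cong_iff_dvd_diff by (rule dvd_diff)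
    also have "\<dots> = - ((\<sigma> s1 - \<sigma> s2) * X x y - (L2 x y - L1 x y))" by (simp add: algebra_simps)
    finally have "[(\<sigma> s1 - \<sigma> s2) * X x y = L2 x y - L1 x y] (mod int q)"
      unfolding cong_iff_dvd_diff by (simp only: dvd_minus_iff)
    hence "[k * ((\<sigma> s1 - \<sigma> s2) * X x y) = k * (L2 x y - L1 x y)] (mod int q)"
      by (rule cong_mult[OF cong_refl])
    moreover have "[(\<sigma> s1 - \<sigma> s2) * k * X x y = 1 * X x y] (mod int q)"
      by (rule cong_mult[OF k cong_refl])
    ultimately show ?thesis by (metis cong_sym cong_trans mult.assoc mult.commute mult_1)
  qed
  have Y: "[Y x y = \<sigma> s1 * (k * (L2 x y - L1 x y)) + L1 x y] (mod int q)" for x y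
    using cong_trans[OF Y1 cong_add[OF cong_mult[OF cong_refl X] cong_refl]] .
  show thesis
  proof (rule that)
    fix x y assume xy: "x \<in> F" "y \<in> F"
    show "[fst (f (x, y)) = (k * (m1 * s1 - m2 * s2)) * x + (k * (m2 - m1)) * y + k * (n2 - n1)] (mod int q)"
      using X[of x y] xy by (simp add: X_def L1_def L2_def algebra_simps)
    show "[snd (f (x, y)) = (\<sigma> s1 * k * (m1 * s1 - m2 * s2) - m1 * s1) * x + (\<sigma> s1 * k * (m2 - m1) + m1) * y
       + (\<sigma> s1 * k * (n2 - n1) + n1)] (mod int q)"
      using Y[of x y] xy by (simp add: Y_def L1_def L2_def algebra_simps)
  qed
qed

end

section \<open>Slope sets invariant under a Moebius transformation\<close>

text \<open>Take T maximal in E with T disjoint from g T. By maximality every element of E lies in T,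
  in g T or in the preimage of T, so T contains a third of E; and an invariant set S is determined
  by S - T.\<close>
lemma card_invariant_subsets_le:
  fixes g :: "'a \<Rightarrow> 'a"
  assumes "finite A" "E \<subseteq> A" "inj_on g E" "\<And>e. e \<in> E \<Longrightarrow> g e \<noteq> e"
    and "\<And>S. S \<in> Z \<Longrightarrow> S \<subseteq> A" "\<And>S e. S \<in> Z \<Longrightarrow> e \<in> E \<Longrightarrow> e \<in> S \<longleftrightarrow> g e \<in> S"
  shows "card Z \<le> 2 ^ (card A - card E div 3)"
proof -
  have finE: "finite E" using assms(1,2) finite_subset by blast
  define \<T> where "\<T> = {T. T \<subseteq> E \<and> T \<inter> g ` T = {}}"
  have fin: "finite \<T>" and ne: "{} \<in> \<T>" using finE by (auto simp: \<T>_def)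
  obtain T where "T \<in> \<T>" and max: "\<And>T'. T' \<in> \<T> \<Longrightarrow> T \<subseteq> T' \<Longrightarrow> T = T'"
    using finite_has_maximal2[OF fin ne] by metis
  hence T: "T \<subseteq> E" "T \<inter> g ` T = {}" by (auto simp: \<T>_def)
  have finT: "finite T" using T finE finite_subset by blast
  have "E \<subseteq> T \<union> g ` T \<union> {e \<in> E. g e \<in> T}"
  proof
    fix e assume e: "e \<in> E"
    show "e \<in> T \<union> g ` T \<union> {e \<in> E. g e \<in> T}"
    proof (rule ccontr)
      assume no: "\<not> ?thesis"
      have "insert e T \<in> \<T>" using T e no assms(4)[OF e] by (auto simp: \<T>_def)
      hence "T = insert e T" using max by blast
      thus False using no by blast
    qed
  qed
  hence "card E \<le> card (T \<union> g ` T \<union> {e \<in> E. g e \<in> T})"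
    using finT finE by (intro card_mono) auto
  also have "\<dots> \<le> card T + card (g ` T) + card {e \<in> E. g e \<in> T}"
    by (meson add_le_mono1 card_Un_le le_trans)
  also have "card (g ` T) \<le> card T" by (rule card_image_le[OF finT])
  also have "card {e \<in> E. g e \<in> T} \<le> card T"
    by (rule card_inj_on_le[of g]) (use assms(3) finT in \<open>auto intro: inj_on_subset\<close>)
  finally have T3: "card E div 3 \<le> card T" by simp
  have "inj_on (\<lambda>S. S - T) Z"
  proof (rule inj_onI)
    fix S S' assume S: "S \<in> Z" "S' \<in> Z" "S - T = S' - T"
    have "e \<in> S \<longleftrightarrow> e \<in> S'" for e
    proof (cases "e \<in> T")
      \<comment> \<open>Membership of a point of T is decided by its image, which lies outside T,
        where S and S' agree.\<close>
      case True
      hence "e \<in> E" "g e \<notin> T" using T by auto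
      thus ?thesis using assms(6)[of S e] assms(6)[of S' e] S by blast
    qed (use S in blast)
    thus "S = S'" by blast
  qed
  hence "card Z \<le> card (Pow (A - T))"
    by (rule card_inj_on_le) (use assms(1,5) in auto)
  also have "\<dots> = 2 ^ (card A - card T)"
    using T assms(1,2) finT by (subst card_Pow) (auto simp: card_Diff_subset)
  also have "\<dots> \<le> 2 ^ (card A - card E div 3)"
    using T3 by (intro power_increasing) auto
  finally show ?thesis .
qed

text \<open>Invariance of the slope set S under s \<mapsto> (c + d s) / (a + b s), the action on slopes of the
  matrix with rows (a, b) and (c, d); a slope sent to infinity must lie outside S.\<close>
definition moebius_invariant :: "nat \<Rightarrow> int \<Rightarrow> int \<Rightarrow> int \<Rightarrow> int \<Rightarrow> int set \<Rightarrow> bool" where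
  "moebius_invariant q a b c d S \<longleftrightarrow> (\<forall>s\<in>{0..<int q}. s \<in> S \<longleftrightarrow>
     \<not> int q dvd a + b * s \<and> (\<exists>t\<in>S. [c + d * s = t * (a + b * s)] (mod int q)))"

text \<open>The matrix is invertible but not scalar modulo q. The residues b, c, d - a are, up to
  sign, the coefficients of the fixed point equation c + (d - a) s - b s^2 = 0, so this equation is
  nontrivial.\<close>

definition nonscalar_mod :: "nat \<Rightarrow> int \<Rightarrow> int \<Rightarrow> int \<Rightarrow> int \<Rightarrow> bool" where
  "nonscalar_mod q a b c d \<longleftrightarrow> \<not> int q dvd a * d - b * c \<and>
     \<not> (int q dvd b \<and> int q dvd c \<and> int q dvd d - a)"

lemma card_poly_roots_mod_prime_le:
  fixes G :: "int poly"
  assumes "prime q" "degree G \<le> n" "\<not> int q dvd coeff G i"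
  shows "card {x \<in> {0..<int q}. int q dvd poly G x} \<le> n"
proof (rule ccontr)
  assume "\<not> ?thesis"
  hence "int q dvd coeff G i"
    using assms by (intro poly_roots_mod_prime[of q "{x \<in> {0..<int q}. int q dvd poly G x}"]) auto
  thus False using assms by blast
qed

text \<open>Removing the at most one pole and the at most two fixed points leaves a set
  \<open>E\<close> of at least q - 3 residues. There the transformation is injective and free of
  fixed points, as the bound for invariant subsets demands.\<close>

lemma card_moebius_invariant_le:
  assumes "prime q" and ns: "nonscalar_mod q a b c d"
  shows "card {S. S \<subseteq> {0..<int q} \<and> moebius_invariant q a b c d S} \<le> 2 ^ (q - (q - 3) div 3)"
proof -
  let ?F = "{0..<int q}" and ?Z = "{S. S \<subseteq> {0..<int q} \<and> moebius_invariant q a b c d S}"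
  have pr: "prime (int q)" using assms by simp
  have det: "\<not> int q dvd a * d - b * c" using ns by (simp add: nonscalar_mod_def)
  define E where "E = {s \<in> ?F. \<not> int q dvd a + b * s \<and> \<not> int q dvd (c + d * s) - s * (a + b * s)}"
  have "\<exists>t\<in>?F. [c + d * s = t * (a + b * s)] (mod int q)" if s: "s \<in> E" for s
  proof -
    obtain k where k: "[(a + b * s) * k = 1] (mod int q)"
      using inverse_mod_prime[OF assms(1), of "a + b * s"] s by (auto simp: E_def)
    have "[((c + d * s) * k) mod int q * (a + b * s) = (c + d * s) * k * (a + b * s)] (mod int q)"
      by (intro cong_mult cong_refl) (simp add: cong_def)
    also have "[(c + d * s) * ((a + b * s) * k) = (c + d * s) * 1] (mod int q)"
      by (intro cong_mult k cong_refl)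
    hence "[(c + d * s) * k * (a + b * s) = c + d * s] (mod int q)" by (simp add: mult_ac)
    finally have "[c + d * s = ((c + d * s) * k) mod int q * (a + b * s)] (mod int q)" by (rule cong_sym)
    moreover have "((c + d * s) * k) mod int q \<in> ?F" using prime_gt_0_nat[OF assms(1)] by simp
    ultimately show ?thesis by blast
  qed
  then obtain g where g: "\<And>s. s \<in> E \<Longrightarrow> g s \<in> ?F"
      "\<And>s. s \<in> E \<Longrightarrow> [c + d * s = g s * (a + b * s)] (mod int q)" by metis
  have unique: "t = g s" if s: "s \<in> E" and t: "t \<in> ?F" "[c + d * s = t * (a + b * s)] (mod int q)" for s t
  proof -
    have "[t * (a + b * s) = g s * (a + b * s)] (mod int q)"
      using g(2)[OF s] t(2) cong_sym cong_trans by blast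
    hence "int q dvd (t - g s) * (a + b * s)" by (simp add: cong_iff_dvd_diff left_diff_distrib)
    hence "int q dvd t - g s" using s pr by (auto simp: E_def prime_dvd_mult_iff)
    thus ?thesis using residue_dvd_diff_iff[OF t(1) g(1)[OF s]] by blast
  qed
  have inj: "inj_on g E"
  proof (rule inj_onI)
    fix s s' assume s: "s \<in> E" and s': "s' \<in> E" and eq: "g s = g s'"
    let ?t = "g s"
    \<comment> \<open>The terms with the common image \<open>?t\<close> cancel, and what remains is
      the determinant times s - s'.\<close>
    have "int q dvd ((c + d * s) - ?t * (a + b * s)) * (a + b * s') - ((c + d * s') - ?t * (a + b * s')) * (a + b * s)"
      using g(2)[OF s] g(2)[OF s'] eq unfolding cong_iff_dvd_diff
      by (intro dvd_diff[OF dvd_mult2 dvd_mult2]) auto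
    also have "\<dots> = (a * d - b * c) * (s - s')" by (simp add: algebra_simps)
    finally have "int q dvd s - s'" using det pr prime_dvd_mult_iff by blast
    thus "s = s'" using residue_dvd_diff_iff s s' by (auto simp: E_def)
  qed
  have no_fix: "g s \<noteq> s" if s: "s \<in> E" for s
  proof
    assume "g s = s"
    hence "int q dvd (c + d * s) - s * (a + b * s)" using g(2)[OF s] by (simp add: cong_iff_dvd_diff)
    thus False using s by (simp add: E_def)
  qed
  have inv: "s \<in> S \<longleftrightarrow> g s \<in> S" if S: "S \<in> ?Z" and s: "s \<in> E" for S s
  proof -
    have "s \<in> S \<longleftrightarrow> (\<exists>t\<in>S. [c + d * s = t * (a + b * s)] (mod int q))"
      using S s by (simp add: moebius_invariant_def E_def)
    thus ?thesis using unique[OF s] g(2)[OF s] S by blast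
  qed
  have roots1: "card {s \<in> ?F. int q dvd poly [:a, b:] s} \<le> 1"
  proof -
    have "\<not> int q dvd coeff [:a, b:] 0 \<or> \<not> int q dvd coeff [:a, b:] 1"
      using det by (auto intro: dvd_diff dvd_mult2)
    moreover have "degree [:a, b:] \<le> 1" by simp
    ultimately show ?thesis using card_poly_roots_mod_prime_le[OF assms(1), of "[:a, b:]" 1] by blast
  qed
  have roots2: "card {s \<in> ?F. int q dvd poly [:c, d - a, - b:] s} \<le> 2"
  proof -
    let ?G = "[:c, d - a, - b:]"
    have "\<not> int q dvd coeff ?G 0 \<or> \<not> int q dvd coeff ?G 1 \<or> \<not> int q dvd coeff ?G 2"
      using ns by (auto simp: nonscalar_mod_def numeral_2_eq_2)
    moreover have "degree ?G \<le> 2" by simp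
    ultimately show ?thesis using card_poly_roots_mod_prime_le[OF assms(1), of ?G 2] by blast
  qed
  have "?F - E \<subseteq> {s \<in> ?F. int q dvd poly [:a, b:] s} \<union> {s \<in> ?F. int q dvd poly [:c, d - a, - b:] s}"
    by (auto simp: E_def algebra_simps)
  hence "card (?F - E) \<le> card ({s \<in> ?F. int q dvd poly [:a, b:] s} \<union> {s \<in> ?F. int q dvd poly [:c, d - a, - b:] s})"
    by (intro card_mono finite_UnI finite_Collect_conjI disjI1) simp_all
  also have "\<dots> \<le> 1 + 2" using roots1 roots2 by (meson add_mono card_Un_le le_trans)
  finally have "card (?F - E) \<le> 3" by simp
  moreover have "card (?F - E) = q - card E"
    by (subst card_Diff_subset) (auto simp: E_def intro: finite_subset[of _ ?F])
  ultimately have cE: "q - 3 \<le> card E" by simp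
  have "card ?Z \<le> 2 ^ (card ?F - card E div 3)"
    by (rule card_invariant_subsets_le[where g = g]) (use inj no_fix inv in \<open>auto simp: E_def\<close>)
  also have "\<dots> \<le> 2 ^ (q - (q - 3) div 3)"
    using div_le_mono[OF cE, of 3] by (intro power_increasing) auto
  finally show ?thesis .
qed

section \<open>Scalings with translations, and the dichotomy for automorphisms\<close>

lemma affine_scalings_eq:
  assumes "prime q"
  shows "affine_scalings q = (\<lambda>(l, b). \<lambda>v\<in>verts q.
    ((l * fst v + fst b) mod int q, (l * snd v + snd b) mod int q)) ` ({1..<int q} \<times> verts q)"
proof -
  interpret residues_prime q "Fq q" using assms(1) by unfold_locales simp_all
  have carrier: "carrier (Fq q) - {\<zero>\<^bsub>Fq q\<^esub>} = {1..<int q}"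
    by (auto simp: residue_ring_def)
  have op: "l \<otimes>\<^bsub>Fq q\<^esub> x \<oplus>\<^bsub>Fq q\<^esub> b = (l * x + b) mod int q" for l x b
    by (simp add: res_add_eq res_mult_eq mod_simps)
  have "{h l b |l b. l \<in> A \<and> b \<in> B} = (\<lambda>(l, b). h l b) ` (A \<times> B)"
    for h :: "int \<Rightarrow> int \<times> int \<Rightarrow> int \<times> int \<Rightarrow> int \<times> int" and A B
    by force
  thus ?thesis unfolding affine_scalings_def carrier op .
qed

text \<open>The value at (0, 0) recovers b, and then the value at (1, 0) recovers l, so distinct
  parameters give distinct maps.\<close>

lemma card_affine_scalings:
  assumes "prime q"
  shows "card (affine_scalings q) = q ^ 2 * (q - 1)"
proof -
  have q: "q > 1" using assms prime_gt_1_nat by blast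
  let ?h = "\<lambda>(l, b). \<lambda>v\<in>verts q. ((l * fst v + fst b) mod int q, (l * snd v + snd b) mod int q)"
  have "inj_on ?h ({1..<int q} \<times> verts q)"
  proof (rule inj_onI)
    fix p p' assume p: "p \<in> {1..<int q} \<times> verts q" "p' \<in> {1..<int q} \<times> verts q" and eq: "?h p = ?h p'"
    obtain l b1 b2 l' b1' b2' where pp: "p = (l, b1, b2)" "p' = (l', b1', b2')" by (metis prod.exhaust)
    have l: "l \<in> {1..<int q}" "l' \<in> {1..<int q}" and b: "(b1, b2) \<in> verts q" "(b1', b2') \<in> verts q"
      using p by (auto simp: pp)
    have "(0, 0) \<in> verts q" "(1, 0) \<in> verts q" using q by (auto simp: verts_eq)
    hence b': "[b1 = b1'] (mod int q)" "[b2 = b2'] (mod int q)" and lb: "[l + b1 = l' + b1'] (mod int q)"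
      using fun_cong[OF eq, of "(0, 0)"] fun_cong[OF eq, of "(1, 0)"] by (auto simp: cong_def pp)
    have "[l = l'] (mod int q)" using cong_diff[OF lb b'(1)] by simp
    thus "p = p'" using l b b' by (simp add: verts_eq cong_def pp)
  qed
  hence "card (affine_scalings q) = card ({1..<int q} \<times> verts q)"
    unfolding affine_scalings_eq[OF assms] by (rule card_image)
  moreover have "nat (int q - 1) = q - 1" by linarith
  ultimately show ?thesis by (simp add: verts_eq card_cartesian_product power2_eq_square)
qed

context slope_graph
begin

text \<open>Both coordinate differences are multiplied by the same unit l, so slopes do not
  change.\<close>

lemma affine_scalings_subset_AutG: "affine_scalings q \<subseteq> AutG q S"
proof
  fix f assume "f \<in> affine_scalings q"
  then obtain l b where l: "l \<in> {1..<int q}" and "b \<in> verts q"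
    and f: "f = (\<lambda>v\<in>verts q. ((l * fst v + fst b) mod int q, (l * snd v + snd b) mod int q))"
    unfolding affine_scalings_eq[OF prime_q] by auto
  have l0: "\<not> int q dvd l" using l by (auto dest: zdvd_imp_le)
  have into: "f v \<in> verts q" if "v \<in> verts q" for v using that q_ge by (simp add: f verts_eq)
  have diff: "[fst (f v) - fst (f u) = l * (fst v - fst u)] (mod int q)"
    "[snd (f v) - snd (f u) = l * (snd v - snd u)] (mod int q)"
    if "u \<in> verts q" "v \<in> verts q" for u v
    using that by (simp_all add: f cong_def mod_diff_eq right_diff_distrib)
  have cancel: "[l * x = l * y] (mod int q) \<longleftrightarrow> [x = y] (mod int q)" for x y
  proof -
    have "[l * x = l * y] (mod int q) \<longleftrightarrow> int q dvd l * (x - y)"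
      by (simp add: cong_iff_dvd_diff right_diff_distrib)
    also have "\<dots> \<longleftrightarrow> int q dvd x - y" using l0 prime_int_q prime_dvd_mult_iff by blast
    finally show ?thesis by (simp add: cong_iff_dvd_diff)
  qed
  have fst_eq: "fst (f u) = fst (f v) \<longleftrightarrow> fst u = fst v" and snd_eq: "snd (f u) = snd (f v) \<longleftrightarrow> snd u = snd v"
    if uv: "u \<in> verts q" "v \<in> verts q" for u v
  proof -
    have "[l * fst u + fst b = l * fst v + fst b] (mod int q) \<longleftrightarrow> [fst u = fst v] (mod int q)"
      "[l * snd u + snd b = l * snd v + snd b] (mod int q) \<longleftrightarrow> [snd u = snd v] (mod int q)"
      using cancel by (simp_all only: cong_add_rcancel)
    moreover have "fst u \<in> F" "fst v \<in> F" "snd u \<in> F" "snd v \<in> F" using uv by (auto simp: verts_eq)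
    ultimately show "fst (f u) = fst (f v) \<longleftrightarrow> fst u = fst v" "snd (f u) = snd (f v) \<longleftrightarrow> snd u = snd v"
      using uv residue_cong_iff by (auto simp: f cong_def)
  qed
  have "inj_on f (verts q)" using fst_eq snd_eq by (metis inj_onI prod_eq_iff)
  moreover from this have "f ` verts q = verts q"
    using into by (intro endo_inj_surj image_subsetI) (simp_all add: verts_eq)
  ultimately have bij: "bij_betw f (verts q) (verts q)" by (simp add: bij_betw_def)
  have "adjS q S u v \<longleftrightarrow> adjS q S (f u) (f v)" if uv: "u \<in> verts q" "v \<in> verts q" for u v
  proof -
    have "[snd (f v) - snd (f u) = s * (fst (f v) - fst (f u))] (mod int q)
        \<longleftrightarrow> [snd v - snd u = s * (fst v - fst u)] (mod int q)" for s
    proof -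
      have "[s * (fst (f v) - fst (f u)) = s * (l * (fst v - fst u))] (mod int q)"
        by (intro cong_mult cong_refl diff uv)
      hence "[snd (f v) - snd (f u) = s * (fst (f v) - fst (f u))] (mod int q)
        \<longleftrightarrow> [l * (snd v - snd u) = s * (l * (fst v - fst u))] (mod int q)"
        using diff(2)[OF uv] by (simp add: cong_def)
      also have "s * (l * (fst v - fst u)) = l * (s * (fst v - fst u))" by (rule mult.left_commute)
      finally show ?thesis unfolding cancel .
    qed
    thus ?thesis using uv into fst_eq[OF uv] by (simp add: adj_iff)
  qed
  thus "f \<in> AutG q S" using bij by (auto simp: AutG_def f)
qed

text \<open>The linear part of \<open>f\<close> is invertible because \<open>f\<close> is injective.
  If it is scalar, \<open>f\<close> is a scaling with translation. Otherwise the pair (0, 0), (1, s)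
  is tested: it is an edge iff s is in S, and its image has difference (a + b s, c + d s).\<close>

lemma aut_scaling_or_moebius:
  assumes f: "f \<in> AutG q S"
  shows "f \<in> affine_scalings q \<or>
    (\<exists>a\<in>F. \<exists>b\<in>F. \<exists>c\<in>F. \<exists>d\<in>F. nonscalar_mod q a b c d \<and> moebius_invariant q a b c d S)"
proof -
  have bij: "bij_betw f (verts q) (verts q)" using f by (simp add: AutG_def)
  have into: "f v \<in> verts q" if "v \<in> verts q" for v using that bij bij_betwE by blast
  obtain a0 b0 c0 d0 e1 e2 where
    f1: "\<And>x y. x \<in> F \<Longrightarrow> y \<in> F \<Longrightarrow> [fst (f (x, y)) = a0 * x + b0 * y + e1] (mod int q)" and
    f2: "\<And>x y. x \<in> F \<Longrightarrow> y \<in> F \<Longrightarrow> [snd (f (x, y)) = c0 * x + d0 * y + e2] (mod int q)"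
    using aut_is_affine[OF f] by metis
  define a b c d where "a = a0 mod int q" and "b = b0 mod int q" and "c = c0 mod int q" and "d = d0 mod int q"
  have abcd: "a \<in> F" "b \<in> F" "c \<in> F" "d \<in> F" unfolding a_def b_def c_def d_def by (rule mod_in_F)+
  have red: "[a0 * x + b0 * y + e1 = a * x + b * y + e1] (mod int q)"
    "[c0 * x + d0 * y + e2 = c * x + d * y + e2] (mod int q)" for x y
    by (intro cong_add cong_mult cong_refl; simp add: a_def b_def c_def d_def cong_def)+
  have F1: "[fst (f (x, y)) = a * x + b * y + e1] (mod int q)" if "x \<in> F" "y \<in> F" for x y
    using f1[OF that] red(1) by (rule cong_trans)
  have F2: "[snd (f (x, y)) = c * x + d * y + e2] (mod int q)" if "x \<in> F" "y \<in> F" for x y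
    using f2[OF that] red(2) by (rule cong_trans)
  have ker: "int q dvd u \<and> int q dvd v" if "int q dvd a * u + b * v" "int q dvd c * u + d * v" for u v
  proof -
    let ?u = "u mod int q" and ?v = "v mod int q"
    have "[a * ?u + b * ?v + e1 = a * u + b * v + e1] (mod int q)"
      "[c * ?u + d * ?v + e2 = c * u + d * v + e2] (mod int q)"
      by (intro cong_add cong_mult cong_refl; simp add: cong_def)+
    moreover have "[a * u + b * v + e1 = a * 0 + b * 0 + e1] (mod int q)"
      "[c * u + d * v + e2 = c * 0 + d * 0 + e2] (mod int q)"
      using that by (simp_all add: cong_iff_dvd_diff)
    moreover have F0: "(0::int) \<in> F" using q_ge by simp
    ultimately have "[fst (f (?u, ?v)) = fst (f (0, 0))] (mod int q)" "[snd (f (?u, ?v)) = snd (f (0, 0))] (mod int q)"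
      using F1[OF mod_in_F mod_in_F, of u v] F1[OF F0 F0] F2[OF mod_in_F mod_in_F, of u v] F2[OF F0 F0]
      unfolding cong_def by simp_all
    moreover have uv: "(?u, ?v) \<in> verts q" "(0, 0) \<in> verts q" using q_ge by (auto simp: verts_eq)
    moreover have "fst (f (?u, ?v)) \<in> F" "snd (f (?u, ?v)) \<in> F" "fst (f (0, 0)) \<in> F" "snd (f (0, 0)) \<in> F"
      using into[OF uv(1)] into[OF uv(2)] unfolding verts_eq mem_Times_iff by blast+
    ultimately have "f (?u, ?v) = f (0, 0)" using residue_cong_iff by (simp add: prod_eq_iff)
    hence "(?u, ?v) = (0, 0)" using bij_betw_imp_inj_on[OF bij] uv by (meson inj_onD)
    thus ?thesis by auto
  qed
  have det: "\<not> int q dvd a * d - b * c"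
  proof
    assume det: "int q dvd a * d - b * c"
    \<comment> \<open>If the determinant vanished, the adjugate vectors (b, -a) and (d, -c) would
      lie in the trivial kernel. Then a and c vanish, and (1, 0) lies in the kernel too.\<close>
    have "int q dvd c * b + d * - a"
      using det by (subst dvd_minus_iff[symmetric]) (simp add: algebra_simps)
    hence "int q dvd a" using ker[of b "- a"] by simp
    moreover have "int q dvd c" using ker[of d "- c"] det by simp
    ultimately have "int q dvd 1" using ker[of 1 0] by simp
    thus False using q_ge by simp
  qed
  show ?thesis
  proof (cases "nonscalar_mod q a b c d")
    case False
    hence "b = 0" "c = 0" "d = a"
      using det abcd residue_dvd_diff_iff[of b q 0] residue_dvd_diff_iff[of c q 0] residue_dvd_diff_iff[of d q a] q_ge
      by (auto simp: nonscalar_mod_def)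
    moreover from this have "a \<noteq> 0" using det by auto
    moreover have "f = (\<lambda>v\<in>verts q. ((a * fst v + fst (e1 mod int q, e2 mod int q)) mod int q,
        (a * snd v + snd (e1 mod int q, e2 mod int q)) mod int q))" (is "f = ?g")
    proof (rule extensionalityI[of _ "verts q"])
      show "f \<in> extensional (verts q)" using f by (simp add: AutG_def)
      fix v assume v: "v \<in> verts q"
      then obtain x y where xy: "v = (x, y)" "x \<in> F" "y \<in> F" by (auto simp: verts_eq)
      have "fst (f v) \<in> F" "snd (f v) \<in> F" using into[OF v] by (auto simp: verts_eq)
      hence "fst (f v) = (a * x + e1) mod int q" "snd (f v) = (a * y + e2) mod int q"
        using F1[OF xy(2,3)] F2[OF xy(2,3)] \<open>b = 0\<close> \<open>c = 0\<close> \<open>d = a\<close> by (simp_all add: cong_def xy)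
      thus "f v = ?g v" using v by (simp add: prod_eq_iff xy mod_add_right_eq)
    qed simp
    moreover have "a \<in> {1..<int q}" using abcd \<open>a \<noteq> 0\<close> by auto
    moreover have "(e1 mod int q, e2 mod int q) \<in> verts q" using q_ge by (simp add: verts_eq)
    ultimately have "f \<in> affine_scalings q"
      unfolding affine_scalings_eq[OF prime_q] by (intro image_eqI[of _ _ "(a, e1 mod int q, e2 mod int q)"]) auto
    thus ?thesis by blast
  next
    case True
    have "s \<in> S \<longleftrightarrow> \<not> int q dvd a + b * s \<and> (\<exists>t\<in>S. [c + d * s = t * (a + b * s)] (mod int q))"
      if s: "s \<in> F" for s
    proof -
      have F01: "(0::int) \<in> F" "(1::int) \<in> F" using q_ge by auto
      have v: "(0, 0) \<in> verts q" "(1, s) \<in> verts q" using F01 s by (auto simp: verts_eq)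
      have "s \<in> S \<longleftrightarrow> adjS q S (0, 0) (1, s)"
        using v s S_sub residue_cong_iff by (subst adj_iff) (auto simp: subset_iff)
      also have "\<dots> \<longleftrightarrow> adjS q S (f (0, 0)) (f (1, s))" using f v by (simp add: AutG_def)
      also have "\<dots> \<longleftrightarrow> fst (f (0, 0)) \<noteq> fst (f (1, s)) \<and>
        (\<exists>t\<in>S. [snd (f (1, s)) - snd (f (0, 0)) = t * (fst (f (1, s)) - fst (f (0, 0)))] (mod int q))"
        using v into by (intro adj_iff) auto
      also have "fst (f (0, 0)) \<noteq> fst (f (1, s)) \<longleftrightarrow> \<not> int q dvd fst (f (1, s)) - fst (f (0, 0))"
        using residue_dvd_diff_iff[of "fst (f (1, s))" q "fst (f (0, 0))"] into[OF v(1)] into[OF v(2)]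
        unfolding verts_eq mem_Times_iff by metis
      finally have main: "s \<in> S \<longleftrightarrow> \<not> int q dvd fst (f (1, s)) - fst (f (0, 0)) \<and>
        (\<exists>t\<in>S. [snd (f (1, s)) - snd (f (0, 0)) = t * (fst (f (1, s)) - fst (f (0, 0)))] (mod int q))" .
      have D1: "[fst (f (1, s)) - fst (f (0, 0)) = a + b * s] (mod int q)"
        using cong_diff[OF F1[OF F01(2) s] F1[OF F01(1,1)]] by simp
      have D2: "[snd (f (1, s)) - snd (f (0, 0)) = c + d * s] (mod int q)"
        using cong_diff[OF F2[OF F01(2) s] F2[OF F01(1,1)]] by simp
      have "int q dvd fst (f (1, s)) - fst (f (0, 0)) \<longleftrightarrow> int q dvd a + b * s"
        using D1 by (simp add: cong_def dvd_eq_mod_eq_0)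
      moreover have "[snd (f (1, s)) - snd (f (0, 0)) = t * (fst (f (1, s)) - fst (f (0, 0)))] (mod int q)
          \<longleftrightarrow> [c + d * s = t * (a + b * s)] (mod int q)" for t
        using D2 cong_mult[OF cong_refl[of t] D1] by (simp add: cong_def)
      ultimately show ?thesis using main by simp
    qed
    hence "moebius_invariant q a b c d S" by (simp add: moebius_invariant_def)
    thus ?thesis using True abcd by blast
  qed
qed

end

section \<open>Counting\<close>

lemma card_half_subsets: "card (half_subsets q) = q choose ((q - 1) div 2)"
proof -
  have "half_subsets q = {S. S \<subseteq> {0..<int q} \<and> card S = (q - 1) div 2}"
    unfolding half_subsets_def residue_ring_def by (intro Collect_cong) auto
  thus ?thesis using n_subsets[of "{0..<int q}" "(q - 1) div 2"] by simp
qed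

text \<open>For odd q the count is a central binomial coefficient, the largest of the q + 1 summands
  of 2^q.\<close>

lemma card_half_subsets_ge:
  assumes "odd q"
  shows "2 ^ q \<le> (q + 1) * card (half_subsets q)"
proof -
  have "(2::nat) ^ q = (\<Sum>k\<le>q. q choose k)" by (simp add: choose_row_sum)
  also have "\<dots> \<le> (\<Sum>k\<le>q. q choose (q div 2))" by (intro sum_mono binomial_maximum)
  also have "\<dots> = (q + 1) * (q choose (q div 2))" by simp
  also have "q div 2 = (q - 1) div 2" using assms by (auto elim: oddE)
  finally show ?thesis unfolding card_half_subsets .
qed

lemma slope_graph_half_subset:
  assumes "prime q" "q \<ge> 7" "S \<in> half_subsets q"
  shows "slope_graph q S"
  using assms by unfold_locales (auto simp: half_subsets_def residue_ring_def)

text \<open>A union bound over the at most q^4 nonscalar matrices with reduced entries; the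
  invariant sets are counted without regard to their size.\<close>

lemma card_bad_slope_sets_le:
  assumes "prime q" "q \<ge> 7"
  shows "card {S \<in> half_subsets q. AutG q S \<noteq> affine_scalings q} \<le> q ^ 4 * 2 ^ (q - (q - 3) div 3)"
proof -
  let ?F = "{0..<int q}"
  define I where "I = {(a, b, c, d) \<in> ?F \<times> ?F \<times> ?F \<times> ?F. nonscalar_mod q a b c d}"
  define Z where "Z = (\<lambda>(a, b, c, d). {S. S \<subseteq> ?F \<and> moebius_invariant q a b c d S})"
  have finI: "finite I" and cI: "card I \<le> q ^ 4"
  proof -
    have sub: "I \<subseteq> ?F \<times> ?F \<times> ?F \<times> ?F" by (auto simp: I_def)
    thus "finite I" using finite_subset by blast
    have "card I \<le> card (?F \<times> ?F \<times> ?F \<times> ?F)" by (rule card_mono[OF _ sub]) simp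
    thus "card I \<le> q ^ 4" by (simp add: card_cartesian_product power4_eq_xxxx)
  qed
  have "{S \<in> half_subsets q. AutG q S \<noteq> affine_scalings q} \<subseteq> (\<Union>i\<in>I. Z i)"
  proof
    fix S assume S: "S \<in> {S \<in> half_subsets q. AutG q S \<noteq> affine_scalings q}"
    then interpret slope_graph q S using slope_graph_half_subset assms by blast
    obtain f where "f \<in> AutG q S" "f \<notin> affine_scalings q"
      using S affine_scalings_subset_AutG by blast
    then obtain a b c d where "(a, b, c, d) \<in> I" "moebius_invariant q a b c d S"
      using aut_scaling_or_moebius[of f] by (auto simp: I_def)
    thus "S \<in> (\<Union>i\<in>I. Z i)" using S_sub by (force simp: Z_def)
  qed
  moreover have "finite (\<Union>i\<in>I. Z i)"
    by (rule finite_subset[of _ "Pow ?F"]) (auto simp: Z_def)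
  ultimately have "card {S \<in> half_subsets q. AutG q S \<noteq> affine_scalings q} \<le> card (\<Union>i\<in>I. Z i)"
    by (intro card_mono)
  also have "\<dots> \<le> (\<Sum>i\<in>I. card (Z i))" by (rule card_UN_le[OF finI])
  also have "\<dots> \<le> (\<Sum>i\<in>I. 2 ^ (q - (q - 3) div 3))"
    using card_moebius_invariant_le[OF assms(1)] by (intro sum_mono) (auto simp: I_def Z_def)
  also have "\<dots> \<le> q ^ 4 * 2 ^ (q - (q - 3) div 3)" using cI by simp
  finally show ?thesis .
qed

section \<open>Probability bounds and the limit\<close>

lemma finite_half_subsets: "finite (half_subsets q)"
  by (rule finite_subset[of _ "Pow {0..<int q}"]) (auto simp: half_subsets_def residue_ring_def)

lemma probS_le_1: "probS q P \<le> 1"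
  unfolding probS_def by (rule divide_le_eq_1[THEN iffD2])
    (auto intro!: card_mono finite_half_subsets simp: card_gt_0_iff)

lemma probS_mono:
  assumes "\<And>S. P S \<Longrightarrow> Q S"
  shows "probS q P \<le> probS q Q"
  unfolding probS_def using assms finite_half_subsets
  by (intro divide_right_mono of_nat_mono card_mono) auto

lemma probS_affine_scalings_ge:
  assumes "prime q" "q \<ge> 7"
  shows "1 - real q ^ 4 * (real q + 1) / 2 powr (real q / 3 - 2)
    \<le> probS q (\<lambda>S. AutG q S = affine_scalings q)"
proof -
  let ?H = "half_subsets q" and ?m = "(q - 3) div 3"
  let ?B = "{S \<in> ?H. AutG q S \<noteq> affine_scalings q}" and ?A = "{S \<in> ?H. AutG q S = affine_scalings q}"
  have "odd q" using assms prime_odd_nat by force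
  hence H: "2 ^ q \<le> (real q + 1) * real (card ?H)"
    using card_half_subsets_ge[of q] by (metis of_nat_1 of_nat_add of_nat_le_iff of_nat_mult of_nat_numeral of_nat_power)
  have Hpos: "0 < card ?H" using card_half_subsets by (simp add: zero_less_binomial_iff)
  have "card ?A + card ?B = card (?A \<union> ?B)"
    using finite_half_subsets by (intro card_Un_disjoint[symmetric]) auto
  also have "?A \<union> ?B = ?H" by blast
  finally have "real (card ?A) = real (card ?H) - real (card ?B)" by linarith
  hence "probS q (\<lambda>S. AutG q S = affine_scalings q) = 1 - real (card ?B) / real (card ?H)"
    using Hpos by (simp add: probS_def field_simps)
  moreover have "real (card ?B) / real (card ?H) \<le> real q ^ 4 * (real q + 1) / 2 powr (real q / 3 - 2)"
  proof -
    have "real (card ?B) \<le> real (q ^ 4 * 2 ^ (q - ?m))"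
      using card_bad_slope_sets_le[OF assms] of_nat_le_iff by blast
    hence "real (card ?B) * 2 ^ ?m \<le> real q ^ 4 * (2 ^ (q - ?m) * 2 ^ ?m)"
      by (simp add: mult_right_mono)
    also have "(2::real) ^ (q - ?m) * 2 ^ ?m = 2 ^ q" by (simp flip: power_add)
    also have "real q ^ 4 * 2 ^ q \<le> real q ^ 4 * ((real q + 1) * real (card ?H))"
      using H by (intro mult_left_mono) auto
    finally have "real (card ?B) / real (card ?H) \<le> real q ^ 4 * (real q + 1) / 2 ^ ?m"
      using Hpos by (simp add: field_simps)
    also have "\<dots> \<le> real q ^ 4 * (real q + 1) / 2 powr (real q / 3 - 2)"
    proof (rule divide_left_mono)
      \<comment> \<open>The rounded exponent is replaced by a real one, so that the asymptotics of
        the bound involve no integer division.\<close>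
      have "real q / 3 - 2 \<le> real ?m" using assms(2) by linarith
      hence "2 powr (real q / 3 - 2) \<le> 2 powr real ?m" by (intro powr_mono) auto
      thus "2 powr (real q / 3 - 2) \<le> 2 ^ ?m" by (simp add: powr_realpow)
    qed auto
    finally show ?thesis .
  qed
  ultimately show ?thesis by linarith
qed

theorem mainTheorem10:
  shows "((\<lambda>q. probS q (\<lambda>S. AutG q S = affine_scalings q)) \<longlongrightarrow> 1)
           (inf at_top (principal {q. prime q \<and> q \<ge> 3}))
       \<and> ((\<lambda>q. probS q (\<lambda>S. card (AutG q S) = q^2 * (q - 1))) \<longlongrightarrow> 1)
           (inf at_top (principal {q. prime q \<and> q \<ge> 3}))"
proof -
  let ?f = "inf at_top (principal {q::nat. prime q \<and> q \<ge> 3})"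
  let ?lower = "\<lambda>q::nat. 1 - real q ^ 4 * (real q + 1) / 2 powr (real q / 3 - 2)"
  have "(?lower \<longlongrightarrow> 1) at_top" by real_asymp
  hence lower: "(?lower \<longlongrightarrow> 1) ?f" by (rule tendsto_mono[rotated]) simp
  have ev: "eventually (\<lambda>q. prime q \<and> q \<ge> 7) ?f"
    unfolding eventually_inf_principal using eventually_ge_at_top[of 7] by eventually_elim auto
  show ?thesis
  proof
    show "((\<lambda>q. probS q (\<lambda>S. AutG q S = affine_scalings q)) \<longlongrightarrow> 1) ?f"
    proof (rule tendsto_sandwich[OF _ _ lower tendsto_const])
      show "eventually (\<lambda>q. ?lower q \<le> probS q (\<lambda>S. AutG q S = affine_scalings q)) ?f"
        using ev by eventually_elim (rule probS_affine_scalings_ge, auto)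
    qed (simp add: probS_le_1)
    show "((\<lambda>q. probS q (\<lambda>S. card (AutG q S) = q^2 * (q - 1))) \<longlongrightarrow> 1) ?f"
    proof (rule tendsto_sandwich[OF _ _ lower tendsto_const])
      show "eventually (\<lambda>q. ?lower q \<le> probS q (\<lambda>S. card (AutG q S) = q^2 * (q - 1))) ?f"
        using ev
      proof eventually_elim
        case (elim q)
        have "?lower q \<le> probS q (\<lambda>S. AutG q S = affine_scalings q)"
          using elim by (intro probS_affine_scalings_ge) auto
        \<comment> \<open>The event of the first claim is contained in that of the second, so the
          same lower bound serves both.\<close>
        also have "\<dots> \<le> probS q (\<lambda>S. card (AutG q S) = q^2 * (q - 1))"
          using elim by (intro probS_mono) (simp add: card_affine_scalings)
        finally show ?case .
      qed
    qed (simp add: probS_le_1)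
  qed
qed

end
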